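(* Let $S$ be a nonempty, bounded, closed and convex subset of a generalized Banach algebra $X$ satisfying the condition $(\mathcal{GP})$. Assume that $A,B,C:S\to X$ are three weakly sequentially continuous operators satisfying the following conditions: (i) $A$ is regular, i.e. $A$ takes values in the set of invertible elements of $X$; (ii) $A$ and $B$ are weakly compact; (iii) if $(x_k)_k$ is a sequence in $S$ with $(I-C)x_k\rightharpoonup y$ for some $y\in X$, then $(x_k)_k$ has a weakly convergent subsequence; (iv) $\left(\frac{I-C}{A}\right)^{-1}$ exists on $B(S)$; (v) if $y\in S$ and $x=Ax\cdot By+Cx\in S$, then $x\in S$. Then the operator equation $x=Ax\cdot Bx+Cx$ has at least one solution $x\in S$.
   Context: $\mathbb{R}^n$ is ordered componentwise. A generalized Banach space (in the sense of Perov) is a real vector space $X$ with a vector-valued norm $\|\cdot\|=(\|\cdot\|_1,\dots,\|\cdot\|_n):X\to\mathbb{R}^n_+$ ($\|x\|=0$ iff $x=0$, $\|\lambda x\|=|\lambda|\|x\|$, $\|x+y\|\le\|x\|+\|y\|$ componentwise), complete for the topology given by $\max_i\|x\|_i$. A generalized Banach algebra is a generalized Banach space that is an algebra with $\|x\cdot y\|_i\le\|x\|_i\|y\|_i$ for all $i$ and all $x,y$; it has a unit whenever invertible elements are mentioned. The weak topology of $X$ is the coarsest topology making all continuous linear functionals continuous; $\rightharpoonup$ is weak convergence. $X$ satisfies $(\mathcal{GP})$ if $x_k\rightharpoonup x$ and $y_k\rightharpoonup y$ imply $x_k\cdot y_k\rightharpoonup x\cdot y$. A map $T$ is weakly sequentially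 continuous if $x_k\rightharpoonup x$ (in its domain) implies $Tx_k\rightharpoonup Tx$; it is weakly compact if it maps bounded subsets of its domain to relatively weakly compact sets. For $A$ regular, $\frac{I-C}{A}$ is the operator sending $x$ (in the common domain of $A$ and $C$) to the unique element $z$ with $Ax\cdot z=x-Cx$; saying $\left(\frac{I-C}{A}\right)^{-1}$ exists on $B(S)$ means that for each $z\in B(S)$ there is exactly one $x$ in that domain with $\left(\frac{I-C}{A}\right)x=z$. *)

theory Defs
  imports "HOL-Analysis.Analysis"
begin

definition vdist :: "('a::real_vector \<Rightarrow> real ^ 'n) \<Rightarrow> 'a \<Rightarrow> 'a \<Rightarrow> real" where
  "vdist vnorm x y = Max (range (\<lambda>i. vnorm (x - y) $ i))"

text \<open>The order on \<open>real ^ 'n\<close> is the componentwise one, so each component of \<open>vnorm\<close> is a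
  seminorm and only the components together separate points.\<close>

locale generalized_normed_space =
  fixes vnorm :: "'a::real_vector \<Rightarrow> real ^ 'n"
  assumes vnorm_nonneg: "0 \<le> vnorm x"
    and vnorm_eq_0_iff: "vnorm x = 0 \<longleftrightarrow> x = 0"
    and vnorm_scaleR: "vnorm (c *\<^sub>R x) = \<bar>c\<bar> *\<^sub>R vnorm x"
    and vnorm_triangle: "vnorm (x + y) \<le> vnorm x + vnorm y"
begin

lemma vnorm_nth_le_vdist: "vnorm (x - y) $ i \<le> vdist vnorm x y"
  by (simp add: vdist_def)

lemma Metric_space_vdist: "Metric_space UNIV (vdist vnorm)"
proof
  fix x y z :: 'a
  have nonneg: "0 \<le> vnorm u $ i" for u i
    using vnorm_nonneg[of u] by (simp add: less_eq_vec_def)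
  show "0 \<le> vdist vnorm x y"
    using nonneg vnorm_nth_le_vdist order_trans by blast
  have "vnorm (- u) = vnorm u" for u
    using vnorm_scaleR[of "-1" u] by simp
  from this[of "x - y"] show "vdist vnorm x y = vdist vnorm y x"
    by (simp add: vdist_def)
  show "vdist vnorm x y = 0 \<longleftrightarrow> x = y"
  proof
    assume "vdist vnorm x y = 0"
    then have "vnorm (x - y) $ i = 0" for i
      using nonneg[of "x - y" i] vnorm_nth_le_vdist[of x y i] by simp
    then have "vnorm (x - y) = 0"
      by (simp add: vec_eq_iff)
    then show "x = y"
      by (simp add: vnorm_eq_0_iff)
  next
    assume "x = y"
    moreover have "vnorm 0 = 0"
      by (simp add: vnorm_eq_0_iff)
    ultimately show "vdist vnorm x y = 0"
      by (simp add: vdist_def)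
  qed
  have "vnorm (x - z) $ i \<le> vdist vnorm x y + vdist vnorm y z" for i
  proof -
    have "vnorm (x - z) $ i \<le> vnorm (x - y) $ i + vnorm (y - z) $ i"
      using vnorm_triangle[of "x - y" "y - z"] by (simp add: less_eq_vec_def)
    then show ?thesis
      using vnorm_nth_le_vdist[of x y i] vnorm_nth_le_vdist[of y z i] by linarith
  qed
  then show "vdist vnorm x z \<le> vdist vnorm x y + vdist vnorm y z"
    by (subst vdist_def) auto
qed

end

locale generalized_banach_space = generalized_normed_space vnorm
  for vnorm :: "'a::real_vector \<Rightarrow> real ^ 'n" +
  assumes complete: "Metric_space.mcomplete UNIV (vdist vnorm)"

text \<open>Neither commutativity nor a normalised unit is required. The class \<open>real_algebra\<close> rather than
  \<open>real_algebra_1\<close> is used so that the zero algebra is not excluded; the existence of a unit is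
  part of \<open>invertible_elem\<close>.\<close>

locale generalized_banach_algebra = generalized_banach_space vnorm
  for vnorm :: "'a::real_algebra \<Rightarrow> real ^ 'n" +
  assumes vnorm_mult: "vnorm (x * y) $ i \<le> vnorm x $ i * vnorm y $ i"

definition is_unit_element :: "'a::real_algebra \<Rightarrow> bool" where
  "is_unit_element e \<longleftrightarrow> (\<forall>x. e * x = x \<and> x * e = x)"

definition invertible_elem :: "'a::real_algebra \<Rightarrow> bool" where
  "invertible_elem a \<longleftrightarrow> (\<exists>e. is_unit_element e \<and> (\<exists>b. a * b = e \<and> b * a = e))"

definition regular_on :: "'a::real_algebra set \<Rightarrow> ('a \<Rightarrow> 'a) \<Rightarrow> bool" where
  "regular_on S A \<longleftrightarrow> (\<forall>x\<in>S. invertible_elem (A x))"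

definition vnorm_topology :: "('a::real_vector \<Rightarrow> real ^ 'n) \<Rightarrow> 'a topology" where
  "vnorm_topology vnorm = Metric_space.mtopology UNIV (vdist vnorm)"

definition weak_topology :: "('a::real_vector \<Rightarrow> real ^ 'n) \<Rightarrow> 'a topology" where
  "weak_topology vnorm = topology_generated_by
     {f -` U |f U. linear f \<and> continuous_map (vnorm_topology vnorm) euclideanreal f \<and> open U}"

definition weakly_converges ::
    "('a::real_vector \<Rightarrow> real ^ 'n) \<Rightarrow> (nat \<Rightarrow> 'a) \<Rightarrow> 'a \<Rightarrow> bool" where
  "weakly_converges vnorm u x \<longleftrightarrow> limitin (weak_topology vnorm) u x sequentially"

definition condition_GP :: "('a::real_algebra \<Rightarrow> real ^ 'n) \<Rightarrow> bool" where
  "condition_GP vnorm \<longleftrightarrow>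
     (\<forall>u v x y. weakly_converges vnorm u x \<longrightarrow> weakly_converges vnorm v y \<longrightarrow>
        weakly_converges vnorm (\<lambda>k. u k * v k) (x * y))"

definition weakly_seq_continuous_on ::
    "('a::real_vector \<Rightarrow> real ^ 'n) \<Rightarrow> 'a set \<Rightarrow> ('a \<Rightarrow> 'a) \<Rightarrow> bool" where
  "weakly_seq_continuous_on vnorm S T \<longleftrightarrow>
     (\<forall>u x. (\<forall>k. u k \<in> S) \<longrightarrow> x \<in> S \<longrightarrow> weakly_converges vnorm u x \<longrightarrow>
        weakly_converges vnorm (\<lambda>k. T (u k)) (T x))"

definition relatively_weakly_compact ::
    "('a::real_vector \<Rightarrow> real ^ 'n) \<Rightarrow> 'a set \<Rightarrow> bool" where
  "relatively_weakly_compact vnorm M \<longleftrightarrow>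
     compactin (weak_topology vnorm) (weak_topology vnorm closure_of M)"

definition vbounded :: "('a::real_vector \<Rightarrow> real ^ 'n) \<Rightarrow> 'a set \<Rightarrow> bool" where
  "vbounded vnorm M \<longleftrightarrow> Metric_space.mbounded UNIV (vdist vnorm) M"

definition weakly_compact_on ::
    "('a::real_vector \<Rightarrow> real ^ 'n) \<Rightarrow> 'a set \<Rightarrow> ('a \<Rightarrow> 'a) \<Rightarrow> bool" where
  "weakly_compact_on vnorm S T \<longleftrightarrow>
     (\<forall>M. M \<subseteq> S \<longrightarrow> vbounded vnorm M \<longrightarrow> relatively_weakly_compact vnorm (T ` M))"

text \<open>The operator \<open>(I - C) / A\<close>. The description is proper only where \<open>A x\<close> is invertible; then
  its value is \<open>(A x)\<^sup>-\<^sup>1 * (x - C x)\<close>, in this order.\<close>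

definition quotient_op :: "('a::real_algebra \<Rightarrow> 'a) \<Rightarrow> ('a \<Rightarrow> 'a) \<Rightarrow> 'a \<Rightarrow> 'a" where
  "quotient_op A C x = (THE z. A x * z = x - C x)"

definition inverse_exists_on :: "'a set \<Rightarrow> ('a \<Rightarrow> 'a) \<Rightarrow> 'a set \<Rightarrow> bool" where
  "inverse_exists_on S F Z \<longleftrightarrow> (\<forall>z\<in>Z. \<exists>!x. x \<in> S \<and> F x = z)"

end

(* If x = T y denotes the solution in S of A x * B y = x - C x, the fixed points of T are the
   solutions sought. By (GP) and (iii), T is weakly sequentially continuous and every sequence of
   values of T has a weakly convergent subsequence, so a fixed point theorem for such maps is needed.
   One passes to a separable closed convex invariant set, on which countably many functionals f_j
   determine the norm. Brouwer's theorem and Schauder projections give x_m in the convex hull of the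
   range of T with |f_j (x_m - T x_m)| <= 1/(m+1) for j < m. A sequential form of Krein's theorem
   gives a weak limit x of a subsequence, and f_j (x - T x) = 0 for all j. *)
theory Submission
  imports Defs
begin

section \<open>Sublinear functionals\<close>

text \<open>The obstacle is that \<open>T\<close> is continuous only along weakly convergent
  sequences. It need not be weakly continuous, so the Schauder-Tychonoff theorem does not apply to
  it directly. On a separable set, weak limits can be identified by countably many functionals once
  weakly convergent subsequences are at hand, and all arguments can be run with sequences. The
  closure of a countable invariant set is again invariant because closed convex sets are weakly
  sequentially closed. The approximate fixed points lie in the convex hull of the range of
  \<open>T\<close>, while compactness is known for the range only; this is why Krein's theorem
  enters. Its proof represents points of the hull as means of finitely supported measures on the
  range. An ultrafilter limit of these measures is in general only finitely additive, and a
  combinatorial selection of blocks takes the place of dominated convergence in the exchange of two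
  limits on which the theorem rests.\<close>

definition sublinear :: "('a::real_vector \<Rightarrow> real) \<Rightarrow> bool" where
  "sublinear p \<longleftrightarrow> (\<forall>x y. p (x + y) \<le> p x + p y) \<and> (\<forall>c x. 0 \<le> c \<longrightarrow> p (c *\<^sub>R x) = c * p x)"

text \<open>Made for functionals defined as infima, for which one inequality of homogeneity is
  immediate; the same inequality for \<open>inverse c\<close> at the point
  \<open>c *\<^sub>R x\<close> gives the other one.\<close>

lemma sublinearI:
  assumes "\<And>x y. p (x + y) \<le> p x + p y"
    and "\<And>c x. 0 < c \<Longrightarrow> p (c *\<^sub>R x) \<le> c * p x"
    and "p 0 = 0"
  shows "sublinear p"
  unfolding sublinear_def
proof (intro conjI allI impI)
  fix c :: real and x :: 'a assume "0 \<le> c"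
  show "p (c *\<^sub>R x) = c * p x"
  proof (cases "c = 0")
    case False
    with \<open>0 \<le> c\<close> have c: "0 < c" by simp
    have "p x = p (inverse c *\<^sub>R (c *\<^sub>R x))" using c by simp
    also have "\<dots> \<le> inverse c * p (c *\<^sub>R x)" using c by (intro assms(2)) simp
    finally have "c * p x \<le> p (c *\<^sub>R x)" using c by (simp add: field_simps)
    with assms(2)[OF c, of x] show ?thesis by simp
  qed (simp add: assms(3))
qed (rule assms(1))

lemma
  assumes "sublinear p"
  shows sublinear_add: "p (x + y) \<le> p x + p y"
    and sublinear_scale: "0 \<le> c \<Longrightarrow> p (c *\<^sub>R x) = c * p x"
    and sublinear_0: "p 0 = 0"
    and sublinear_minus_le: "- p (- x) \<le> p x"
proof -
  show add: "p (x + y) \<le> p x + p y" for x y using assms by (simp add: sublinear_def)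
  show sc: "0 \<le> c \<Longrightarrow> p (c *\<^sub>R x) = c * p x" for c x using assms by (simp add: sublinear_def)
  show z: "p 0 = 0" using sc[of 0 0] by simp
  show "- p (- x) \<le> p x" using add[of x "- x"] z by simp
qed

text \<open>The infimum of \<open>p (x + t *\<^sub>R c) - t * \<beta>\<close> over
  \<open>t \<ge> 0\<close> and \<open>c \<in> C\<close> works: \<open>t = 0\<close> gives the bound
  by \<open>p\<close>, and \<open>t = 1\<close> at the point \<open>- c\<close> gives
  \<open>p 0 - \<beta>\<close>. A linear functional below \<open>q\<close> is then below
  \<open>p\<close> and at least \<open>\<beta>\<close> on \<open>C\<close>.\<close>

lemma sublinear_shift:
  assumes p: "sublinear p" and C: "convex C" "C \<noteq> {}" and \<beta>: "\<And>c. c \<in> C \<Longrightarrow> \<beta> \<le> p c"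
  obtains q where "sublinear q" "\<And>x. q x \<le> p x" "\<And>c. c \<in> C \<Longrightarrow> q (- c) \<le> - \<beta>"
proof -
  define I where "I = {0::real..} \<times> C"
  define v where "v x = (\<lambda>(t, c). p (x + t *\<^sub>R c) - t * \<beta>)" for x
  define q where "q x = (INF i\<in>I. v x i)" for x
  have I: "I \<noteq> {}" using C(2) by (auto simp: I_def)
  \<comment> \<open>This lower bound makes the infimum a real number; it is the place where the
    hypothesis on \<open>p\<close> over \<open>C\<close> enters.\<close>
  have lb: "- p (- x) \<le> v x i" if iI: "i \<in> I" for x i
  proof -
    obtain t c where i: "i = (t, c)" "0 \<le> t" "c \<in> C" using iI by (auto simp: I_def)
    have "t * \<beta> \<le> p (t *\<^sub>R c)" using i \<beta> by (simp add: sublinear_scale[OF p] mult_left_mono)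
    also have "\<dots> = p ((x + t *\<^sub>R c) + (- x))" by simp
    also have "\<dots> \<le> p (x + t *\<^sub>R c) + p (- x)" by (rule sublinear_add[OF p])
    finally show ?thesis by (simp add: i v_def)
  qed
  have bdd: "bdd_below (v x ` I)" for x using lb by (intro bdd_belowI2)
  have le: "q x \<le> v x i" if "i \<in> I" for x i
    unfolding q_def by (rule cINF_lower[OF bdd that])
  have ge: "m \<le> q x" if "\<And>i. i \<in> I \<Longrightarrow> m \<le> v x i" for x m
    unfolding q_def using that by (intro cINF_greatest[OF I])
  have qp: "q x \<le> p x" for x
    using C(2) le[of "(0, SOME c. c \<in> C)" x] by (auto simp: I_def v_def some_in_eq)
  have "sublinear q"
  proof (rule sublinearI)
    have "- p (- 0) \<le> q 0" by (rule ge) (rule lb)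
    then show "q 0 = 0" using qp[of 0] sublinear_0[OF p] by simp
  next
    fix c :: real and x assume c: "0 < c"
    have "q (c *\<^sub>R x) / c \<le> q x"
    proof (rule ge)
      fix i assume "i \<in> I"
      then obtain t d where i: "i = (t, d)" "0 \<le> t" "d \<in> C" by (auto simp: I_def)
      have "q (c *\<^sub>R x) \<le> v (c *\<^sub>R x) (c * t, d)" using i c by (intro le) (auto simp: I_def)
      also have "\<dots> = p (c *\<^sub>R (x + t *\<^sub>R d)) - c * t * \<beta>" by (simp add: v_def scaleR_add_right)
      also have "p (c *\<^sub>R (x + t *\<^sub>R d)) = c * p (x + t *\<^sub>R d)" using c by (simp only: sublinear_scale[OF p])
      also have "\<dots> - c * t * \<beta> = c * v x i" by (simp add: i v_def algebra_simps)
      finally show "q (c *\<^sub>R x) / c \<le> v x i" using c by (simp add: field_simps)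
    qed
    then show "q (c *\<^sub>R x) \<le> c * q x" using c by (simp add: field_simps)
  next
    fix x y
    have *: "q (x + y) \<le> v x i + v y j" if ij: "i \<in> I" "j \<in> I" for i j
    proof -
      obtain t c s d where i: "i = (t, c)" "0 \<le> t" "c \<in> C" "j = (s, d)" "0 \<le> s" "d \<in> C"
        using ij by (auto simp: I_def)
      \<comment> \<open>Convexity closes the cone over \<open>C\<close> under addition, so
        admissible parameters for \<open>x\<close> and for \<open>y\<close> combine into one for
        \<open>x + y\<close>.\<close>
      obtain e where e: "e \<in> C" "(t + s) *\<^sub>R e = t *\<^sub>R c + s *\<^sub>R d"
      proof (cases "t + s = 0")
        case True
        then have "t = 0" "s = 0" using i by auto
        with that i show ?thesis by auto
      next
        case False
        then have ts: "0 < t + s" using i by simp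
        have "(t / (t + s)) *\<^sub>R c + (s / (t + s)) *\<^sub>R d \<in> C"
          using i ts by (intro convexD[OF C(1)]) (auto simp: add_divide_distrib[symmetric])
        with that[of "(t / (t + s)) *\<^sub>R c + (s / (t + s)) *\<^sub>R d"] ts show ?thesis
          by (simp add: scaleR_add_right)
      qed
      have "q (x + y) \<le> v (x + y) (t + s, e)" using i e by (intro le) (auto simp: I_def)
      also have "\<dots> = p ((x + t *\<^sub>R c) + (y + s *\<^sub>R d)) - (t + s) * \<beta>"
        unfolding v_def prod.case e(2) by (simp only: ac_simps)
      also have "\<dots> \<le> v x i + v y j"
        using sublinear_add[OF p, of "x + t *\<^sub>R c" "y + s *\<^sub>R d"] by (simp add: v_def i algebra_simps)
      finally show ?thesis .
    qed
    have "q (x + y) - v x i \<le> q y" if "i \<in> I" for i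
      using *[OF that] by (intro ge) (simp add: algebra_simps)
    then have "q (x + y) - q y \<le> q x" by (intro ge) (simp add: algebra_simps)
    then show "q (x + y) \<le> q x + q y" by simp
  qed
  moreover have "q (- c) \<le> - \<beta>" if "c \<in> C" for c
    using le[of "(1, c)" "- c"] that sublinear_0[OF p] by (auto simp: I_def v_def)
  ultimately show thesis using that qp by blast
qed

text \<open>The pointwise infimum is finite because every member of the chain is bounded below by
  \<open>- p (- x)\<close>.\<close>

lemma chain_sublinear_lower_bound:
  assumes ne: "K \<noteq> {}" and K: "\<And>f. f \<in> K \<Longrightarrow> sublinear f \<and> (\<forall>x. f x \<le> p x)"
    and ch: "\<And>f g. f \<in> K \<Longrightarrow> g \<in> K \<Longrightarrow> (\<forall>x. f x \<le> g x) \<or> (\<forall>x. g x \<le> f x)"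
  obtains q where "sublinear q" "\<And>x. q x \<le> p x" "\<And>f x. f \<in> K \<Longrightarrow> q x \<le> f x"
proof -
  define q where "q x = (INF f\<in>K. f x)" for x
  have lb: "- p (- x) \<le> f x" if "f \<in> K" for f x
  proof -
    have "- f (- x) \<le> f x" "f (- x) \<le> p (- x)"
      using K[OF that] sublinear_minus_le[of f x] by auto
    then show ?thesis by linarith
  qed
  have le: "q x \<le> f x" if "f \<in> K" for f x
    unfolding q_def using lb that by (intro cINF_lower bdd_belowI2)
  have ge: "m \<le> q x" if "\<And>f. f \<in> K \<Longrightarrow> m \<le> f x" for x m
    unfolding q_def using that by (intro cINF_greatest[OF ne])
  have "sublinear q"
  proof (rule sublinearI)
    have z: "f 0 = 0" if "f \<in> K" for f using K[OF that] sublinear_0 by blast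
    obtain f where f: "f \<in> K" using ne by blast
    have "0 \<le> q 0" by (rule ge) (simp only: z order_refl)
    then show "q 0 = 0" using le[OF f, of 0] z[OF f] by simp
  next
    fix c :: real and x assume c: "0 < c"
    have "q (c *\<^sub>R x) / c \<le> q x"
    proof (rule ge)
      fix f assume f: "f \<in> K"
      have "f (c *\<^sub>R x) = c * f x" using K[OF f] c by (simp add: sublinear_scale)
      with le[OF f, of "c *\<^sub>R x"] c show "q (c *\<^sub>R x) / c \<le> f x" by (simp add: field_simps)
    qed
    then show "q (c *\<^sub>R x) \<le> c * q x" using c by (simp add: field_simps)
  next
    fix x y
    \<comment> \<open>The smaller of \<open>f\<close> and \<open>g\<close> serves at both points at
      once; this is where the family has to be a chain.\<close>
    have *: "q (x + y) \<le> f x + g y" if fg: "f \<in> K" "g \<in> K" for f g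
    proof -
      obtain h where h: "h \<in> K" "h x \<le> f x" "h y \<le> g y" using ch[OF fg] fg by blast
      have "q (x + y) \<le> h (x + y)" by (rule le[OF h(1)])
      also have "\<dots> \<le> h x + h y" using K[OF h(1)] by (simp add: sublinear_add)
      finally show ?thesis using h by linarith
    qed
    have "q (x + y) - f x \<le> q y" if "f \<in> K" for f
      using *[OF that] by (intro ge) (simp add: algebra_simps)
    then have "q (x + y) - q y \<le> q x" by (intro ge) (simp add: algebra_simps)
    then show "q (x + y) \<le> q x + q y" by simp
  qed
  moreover have "q x \<le> p x" for x using ne K le order_trans by blast
  ultimately show thesis using that le by blast
qed

text \<open>A minimal sublinear functional \<open>m\<close> below \<open>p\<close> is linear: shifting it along \<open>{x}\<close> with
  \<open>\<beta> = m x\<close> cannot decrease it any further, so \<open>m (- x) \<le> - m x\<close>.\<close>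

lemma ex_linear_le_sublinear:
  assumes p: "sublinear p"
  obtains f where "linear f" "\<And>x. f x \<le> p x"
proof -
  define A where "A = {f. sublinear f \<and> (\<forall>x. f x \<le> p x)}"
  \<comment> \<open>The order is reversed, so that the maximal element given by Zorn's lemma is a
    minimal functional.\<close>
  define P where "P f g \<longleftrightarrow> (\<forall>x. g x \<le> f x)" for f g :: "'a \<Rightarrow> real"
  have "\<exists>m\<in>A. \<forall>a\<in>A. P m a \<longrightarrow> a = m"
  proof (rule predicate_Zorn)
    show "partial_order_on A (relation_of P A)"
    proof (rule partial_order_on_relation_ofI)
      show "P a a" if "a \<in> A" for a by (simp add: P_def)
      show "P a c" if "P a b" "P b c" for a b c using that unfolding P_def by (meson order_trans)
      show "a = b" if "P a b" "P b a" for a b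
        using that unfolding P_def by (intro ext order_antisym) auto
    qed
  next
    fix K assume K: "K \<in> Chains (relation_of P A)"
    show "\<exists>u\<in>A. \<forall>a\<in>K. P a u"
    proof (cases "K = {}")
      case True
      then show ?thesis using p by (auto simp: A_def)
    next
      case False
      have KA: "sublinear f \<and> (\<forall>x. f x \<le> p x)" if "f \<in> K" for f
        using K that by (auto simp: Chains_def relation_of_def A_def)
      have ch: "(\<forall>x. f x \<le> g x) \<or> (\<forall>x. g x \<le> f x)" if "f \<in> K" "g \<in> K" for f g
        using K that by (auto simp: Chains_def relation_of_def P_def)
      obtain q where "sublinear q" "\<And>x. q x \<le> p x" "\<And>f x. f \<in> K \<Longrightarrow> q x \<le> f x"
        using chain_sublinear_lower_bound[OF False KA ch] by metis
      then show ?thesis by (intro bexI[of _ q]) (auto simp: A_def P_def)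
    qed
  qed
  then obtain m where mA: "m \<in> A" and mmin: "\<And>a. a \<in> A \<Longrightarrow> P m a \<Longrightarrow> a = m" by blast
  from mA have m: "sublinear m" "\<And>x. m x \<le> p x" by (auto simp: A_def)
  have min: "a = m" if a: "sublinear a" "\<And>x. a x \<le> m x" for a
    using a order_trans[OF a(2) m(2)] by (intro mmin) (simp_all add: A_def P_def)
  have neg: "m (- x) = - m x" for x
  proof -
    obtain q where "sublinear q" "\<And>y. q y \<le> m y" "q (- x) \<le> - m x"
      using sublinear_shift[OF m(1), of "{x}" "m x"] by auto
    then have "q = m" "q (- x) \<le> - m x" by (auto intro: min)
    then show ?thesis using sublinear_minus_le[OF m(1), of x] by simp
  qed
  have "linear m"
  proof (rule linearI)
    fix x y
    show "m (x + y) = m x + m y"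
      using sublinear_add[OF m(1), of x y] sublinear_add[OF m(1), of "x + y" "- y"] neg[of y] by simp
  next
    fix c x
    show "m (c *\<^sub>R x) = c *\<^sub>R m x"
    proof (cases "0 \<le> c")
      case False
      then have "m ((- c) *\<^sub>R x) = - c * m x" by (intro sublinear_scale[OF m(1)]) simp
      then show ?thesis using neg[of "c *\<^sub>R x"] by simp
    qed (simp add: sublinear_scale[OF m(1)])
  qed
  with m that show thesis by blast
qed

text \<open>A form of the Hahn-Banach theorem with a convex set in place of a subspace: a linear
  functional below the shifted \<open>q\<close> satisfies \<open>f (- c) \<le> - \<beta>\<close>.
  With a norm as \<open>p\<close> and a set of differences as \<open>C\<close> it separates convex
  sets.\<close>

theorem mazur_orlicz:
  assumes "sublinear p" "convex C" "\<And>c. c \<in> C \<Longrightarrow> \<beta> \<le> p c"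
  obtains f where "linear f" "\<And>x. f x \<le> p x" "\<And>c. c \<in> C \<Longrightarrow> \<beta> \<le> f c"
proof (cases "C = {}")
  case True
  then show thesis using ex_linear_le_sublinear[OF assms(1)] that by (metis empty_iff)
next
  case False
  obtain q where q: "sublinear q" "\<And>x. q x \<le> p x" "\<And>c. c \<in> C \<Longrightarrow> q (- c) \<le> - \<beta>"
    using sublinear_shift[OF assms(1,2) False assms(3)] by blast
  obtain f where f: "linear f" "\<And>x. f x \<le> q x" using ex_linear_le_sublinear[OF q(1)] by blast
  have "\<beta> \<le> f c" if "c \<in> C" for c
    using f(2)[of "- c"] q(3)[OF that] linear_neg[OF f(1), of c] by simp
  moreover have "f x \<le> p x" for x using f(2)[of x] q(2)[of x] by linarith
  ultimately show thesis using that f(1) by blast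
qed

section \<open>Limits along a free ultrafilter\<close>

text \<open>A minimal proper filter decides every \<open>P\<close>: if the negation of
  \<open>P\<close> does not hold eventually, adjoining \<open>P\<close> keeps the filter proper and
  hence changes nothing.\<close>

lemma ex_ultrafilter_le:
  fixes G :: "'a filter"
  assumes "G \<noteq> bot"
  obtains U where "U \<noteq> bot" "U \<le> G" "\<And>P. eventually P U \<or> eventually (\<lambda>x. \<not> P x) U"
proof -
  define A where "A = {F. F \<noteq> bot \<and> F \<le> G}"
  have "\<exists>m\<in>A. \<forall>a\<in>A. m \<ge> a \<longrightarrow> a = m"
  proof (rule predicate_Zorn)
    show "partial_order_on A (relation_of (\<ge>) A)"
      by (rule partial_order_on_relation_ofI) auto
  next
    fix K assume K: "K \<in> Chains (relation_of (\<ge>) A)"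
    have KA: "F \<in> A" if "F \<in> K" for F using K that by (auto simp: Chains_def relation_of_def)
    have ch: "F \<le> F' \<or> F' \<le> F" if "F \<in> K" "F' \<in> K" for F F'
      using K that by (auto simp: Chains_def relation_of_def)
    show "\<exists>u\<in>A. \<forall>a\<in>K. a \<ge> u"
    proof (cases "K = {}")
      case True
      then show ?thesis using assms by (auto simp: A_def)
    next
      case False
      \<comment> \<open>A property holds eventually along the infimum of a chain exactly if it does
        so along some member, so \<open>False\<close> cannot.\<close>
      have "eventually P (Inf K) \<longleftrightarrow> (\<exists>b\<in>K. eventually P b)" for P
        using ch by (intro eventually_Inf_base[OF False]) (metis inf.idem inf_mono order_refl le_inf_iff)
      then have "Inf K \<noteq> bot"
        using KA unfolding A_def trivial_limit_def by blast
      moreover have "Inf K \<le> G" using False KA unfolding A_def by (auto intro: Inf_lower2)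
      ultimately show ?thesis by (auto simp: A_def intro: Inf_lower)
    qed
  qed
  then obtain U where U: "U \<noteq> bot" "U \<le> G" and min: "\<And>F. F \<noteq> bot \<Longrightarrow> F \<le> U \<Longrightarrow> F = U"
    unfolding A_def by (metis (mono_tags, lifting) mem_Collect_eq order_trans)
  have "eventually P U \<or> eventually (\<lambda>x. \<not> P x) U" for P
  proof (rule disjCI)
    assume "\<not> eventually (\<lambda>x. \<not> P x) U"
    then have "inf U (principal {x. P x}) \<noteq> bot"
      by (simp add: trivial_limit_def eventually_inf_principal)
    then have "inf U (principal {x. P x}) = U" by (intro min) auto
    moreover have "eventually P (inf U (principal {x. P x}))" by (simp add: eventually_inf_principal)
    ultimately show "eventually P U" by simp
  qed
  with U that show thesis by blast
qed

text \<open>Compactness of an interval gives a cluster point of the image filter, and an ultrafilter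
  converges to each of its cluster points.\<close>

lemma bounded_tendsto_ultrafilter:
  fixes s :: "'b \<Rightarrow> real"
  assumes U: "U \<noteq> bot" "\<And>P. eventually P U \<or> eventually (\<lambda>x. \<not> P x) U"
    and bd: "\<And>n. \<bar>s n\<bar> \<le> R"
  shows "\<exists>l. (s \<longlongrightarrow> l) U"
proof -
  have "compact {-R..R}" by simp
  moreover have "filtermap s U \<noteq> bot" using U(1) by (simp add: filtermap_bot_iff)
  moreover have "eventually (\<lambda>x. x \<in> {-R..R}) (filtermap s U)"
    using bd by (auto simp: eventually_filtermap abs_le_iff minus_le_iff)
  ultimately obtain l where l: "inf (nhds l) (filtermap s U) \<noteq> bot"
    unfolding compact_filter by blast
  have "(s \<longlongrightarrow> l) U"
  proof (rule topological_tendstoI)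
    fix W assume W: "open W" "l \<in> W"
    show "eventually (\<lambda>x. s x \<in> W) U"
    proof (rule ccontr)
      assume "\<not> ?thesis"
      then have "eventually (\<lambda>x. s x \<notin> W) U" using U(2) by blast
      then have "eventually (\<lambda>y. y \<notin> W) (inf (nhds l) (filtermap s U))"
        by (intro filter_leD[OF inf_le2]) (simp add: eventually_filtermap)
      moreover have "eventually (\<lambda>y. y \<in> W) (inf (nhds l) (filtermap s U))"
        using W by (intro filter_leD[OF inf_le1]) (rule eventually_nhds_in_open)
      ultimately have "eventually (\<lambda>y. False) (inf (nhds l) (filtermap s U))"
        by eventually_elim simp
      then show False using l by (simp add: trivial_limit_def)
    qed
  qed
  then show ?thesis by blast
qed

section \<open>Subsequences\<close>

text \<open>A product of countably many compact intervals is compact and metrizable, hence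
  sequentially compact; this replaces an explicit diagonal construction.\<close>

lemma diagonal_convergent_subseq:
  fixes s :: "nat \<Rightarrow> nat \<Rightarrow> real"
  assumes "\<And>j n. \<bar>s j n\<bar> \<le> R j"
  obtains r :: "nat \<Rightarrow> nat" where "strict_mono r" "\<And>j. convergent (\<lambda>n. s j (r n))"
proof -
  have "compactin (product_topology (\<lambda>j. euclidean) UNIV) (PiE UNIV (\<lambda>j. {- R j..R j}))"
    by (simp add: compactin_PiE)
  then have "compact (PiE UNIV (\<lambda>j. {- R j..R j}) :: (nat \<Rightarrow> real) set)"
    by (simp add: euclidean_product_topology)
  then have "seq_compact (PiE UNIV (\<lambda>j. {- R j..R j}) :: (nat \<Rightarrow> real) set)"
    by (simp add: compact_eq_seq_compact_metric)
  moreover have "\<forall>n. (\<lambda>j. s j n) \<in> PiE UNIV (\<lambda>j. {- R j..R j})"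
    using assms by (auto simp: PiE_iff abs_le_iff minus_le_iff)
  ultimately obtain l r where r: "strict_mono (r :: nat \<Rightarrow> nat)" "((\<lambda>n. (\<lambda>j. s j n)) \<circ> r) \<longlonglongrightarrow> l"
    unfolding seq_compact_def by metis
  have "(\<lambda>n. s j (r n)) \<longlonglongrightarrow> l j" for j
  proof -
    have "continuous_on UNIV (\<lambda>f :: nat \<Rightarrow> real. f j)" by (rule continuous_on_product_coordinates)
    from continuous_on_tendsto_compose[OF this r(2)] show ?thesis by (simp add: o_def)
  qed
  then show thesis using that r(1) by (auto simp: convergent_def)
qed

lemma tendsto_if_subseqs:
  fixes s :: "nat \<Rightarrow> real"
  assumes "\<And>r. strict_mono r \<Longrightarrow> \<exists>q :: nat \<Rightarrow> nat. strict_mono q \<and> (\<lambda>n. s (r (q n))) \<longlonglongrightarrow> L"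
  shows "s \<longlonglongrightarrow> L"
proof (rule ccontr)
  assume "\<not> ?thesis"
  then obtain e where e: "0 < e" "\<And>M. \<exists>n\<ge>M. e \<le> \<bar>s n - L\<bar>"
    unfolding LIMSEQ_iff by (auto simp: not_less)
  then have "infinite {n. e \<le> \<bar>s n - L\<bar>}" by (auto simp: infinite_nat_iff_unbounded_le)
  then obtain r :: "nat \<Rightarrow> nat" where r: "strict_mono r" "\<And>n. e \<le> \<bar>s (r n) - L\<bar>"
    using infinite_enumerate[of "{n. e \<le> \<bar>s n - L\<bar>}"] by auto
  obtain q :: "nat \<Rightarrow> nat" where "(\<lambda>n. s (r (q n))) \<longlonglongrightarrow> L" using assms[OF r(1)] by blast
  then obtain n where "\<bar>s (r (q n)) - L\<bar> < e"
    using e(1) unfolding LIMSEQ_iff by (metis order_refl real_norm_def)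
  then show False using r(2)[of "q n"] by linarith
qed

section \<open>Weak sequential convergence in a normed space given by its norm function\<close>

text \<open>The norm is a parameter instead of a type class instance because it will be the largest
  component of \<open>vnorm\<close>, itself a variable.\<close>

locale norm_function =
  fixes N :: "'a::real_vector \<Rightarrow> real"
  assumes N_eq_0_iff: "N x = 0 \<longleftrightarrow> x = 0"
    and N_scale: "N (c *\<^sub>R x) = \<bar>c\<bar> * N x"
    and N_triangle: "N (x + y) \<le> N x + N y"
begin

lemma N_0 [simp]: "N 0 = 0"
  by (simp add: N_eq_0_iff)

lemma N_minus: "N (- x) = N x"
  using N_scale[of "-1" x] by simp

lemma N_nonneg [simp]: "0 \<le> N x"
  using N_triangle[of x "- x"] by (simp add: N_minus)

lemma N_commute: "N (x - y) = N (y - x)"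
  using N_minus[of "x - y"] by simp

lemma N_diff_triangle: "N (x - z) \<le> N (x - y) + N (y - z)"
  using N_triangle[of "x - y" "y - z"] by simp

lemma sublinear_N: "sublinear N"
  by (simp add: sublinear_def N_triangle N_scale)

definition dual :: "('a \<Rightarrow> real) set" where
  "dual = {f. linear f \<and> (\<exists>C. \<forall>x. \<bar>f x\<bar> \<le> C * N x)}"

definition dual_ball :: "('a \<Rightarrow> real) set" where
  "dual_ball = {f. linear f \<and> (\<forall>x. \<bar>f x\<bar> \<le> N x)}"

text \<open>Weak convergence is kept free of topologies here; \<open>weakly_converges_eq\<close>
  identifies it with convergence in the weak topology.\<close>

definition wconv :: "(nat \<Rightarrow> 'a) \<Rightarrow> 'a \<Rightarrow> bool" where
  "wconv u x \<longleftrightarrow> (\<forall>f\<in>dual. (\<lambda>n. f (u n)) \<longlonglongrightarrow> f x)"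

definition nclosed :: "'a set \<Rightarrow> bool" where
  "nclosed S \<longleftrightarrow> (\<forall>x. (\<forall>e>0. \<exists>s\<in>S. N (x - s) < e) \<longrightarrow> x \<in> S)"

definition ncl :: "'a set \<Rightarrow> 'a set" where
  "ncl D = {x. \<forall>e>0. \<exists>d\<in>D. N (x - d) < e}"

lemma dual_ball_subset: "f \<in> dual_ball \<Longrightarrow> f \<in> dual"
  unfolding dual_ball_def dual_def by (auto intro: exI[of _ 1])

lemma dual_linear: "f \<in> dual \<Longrightarrow> linear f"
  by (simp add: dual_def)

lemma dual_ball_linear: "f \<in> dual_ball \<Longrightarrow> linear f"
  by (simp add: dual_ball_def)

lemma dual_ball_le: "f \<in> dual_ball \<Longrightarrow> \<bar>f x\<bar> \<le> N x"
  by (simp add: dual_ball_def)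

lemma dual_ballI:
  assumes "linear f" "\<And>x. f x \<le> N x"
  shows "f \<in> dual_ball"
  unfolding dual_ball_def
proof (safe)
  fix x
  show "\<bar>f x\<bar> \<le> N x"
    using assms(2)[of x] assms(2)[of "- x"] linear_neg[OF assms(1), of x] by (simp add: N_minus)
qed (rule assms(1))

lemma dual_bound:
  assumes "f \<in> dual"
  obtains C where "0 < C" "\<And>x. \<bar>f x\<bar> \<le> C * N x"
proof -
  obtain C where C: "\<And>x. \<bar>f x\<bar> \<le> C * N x" using assms by (auto simp: dual_def)
  have "C * N x \<le> (\<bar>C\<bar> + 1) * N x" for x by (intro mult_right_mono) auto
  then have "\<bar>f x\<bar> \<le> (\<bar>C\<bar> + 1) * N x" for x using C[of x] order_trans by blast
  then show thesis by (intro that[of "\<bar>C\<bar> + 1"]) auto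
qed

lemma dual_scale_ball:
  assumes "f \<in> dual"
  obtains C h where "0 < C" "h \<in> dual_ball" "\<And>x. f x = C * h x"
proof -
  obtain C where C: "0 < C" "\<And>x. \<bar>f x\<bar> \<le> C * N x" using dual_bound[OF assms] by blast
  have "(\<lambda>x. f x / C) \<in> dual_ball"
    unfolding dual_ball_def
  proof (safe)
    show "linear (\<lambda>x. f x / C)"
      by (intro linearI) (auto simp: linear_add[OF dual_linear[OF assms]]
          linear_scale[OF dual_linear[OF assms]] add_divide_distrib)
    show "\<bar>f x / C\<bar> \<le> N x" for x
      using C(1) C(2)[of x] by (simp add: field_simps)
  qed
  then show thesis using C(1) by (intro that[of C "\<lambda>x. f x / C"]) auto
qed

lemma dual_diff:
  assumes f: "f \<in> dual" and g: "g \<in> dual"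
  shows "(\<lambda>x. f x - g x) \<in> dual"
proof -
  obtain C D where C: "\<And>x. \<bar>f x\<bar> \<le> C * N x" and D: "\<And>x. \<bar>g x\<bar> \<le> D * N x"
    using f g by (auto simp: dual_def)
  have "linear (\<lambda>x. f x - g x)"
    using f g by (intro linear_compose_sub) (auto simp: dual_def)
  moreover have "\<bar>f x - g x\<bar> \<le> (C + D) * N x" for x
    using C[of x] D[of x] by (simp add: distrib_right)
  ultimately show ?thesis by (auto simp: dual_def)
qed

lemma wconv_dual: "wconv u x \<Longrightarrow> f \<in> dual \<Longrightarrow> (\<lambda>n. f (u n)) \<longlonglongrightarrow> f x"
  by (simp add: wconv_def)

lemma wconv_subseq: "wconv u x \<Longrightarrow> strict_mono r \<Longrightarrow> wconv (\<lambda>n. u (r n)) x"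
  unfolding wconv_def using LIMSEQ_subseq_LIMSEQ[of "\<lambda>n. f (u n)" for f]
  by (fastforce simp: o_def)

lemma wconv_diff:
  "wconv u x \<Longrightarrow> wconv v y \<Longrightarrow> wconv (\<lambda>n. u n - v n) (x - y)"
  unfolding wconv_def by (simp add: linear_diff[OF dual_linear] tendsto_diff)

lemma norm_conv_imp_wconv:
  assumes "(\<lambda>n. N (u n - x)) \<longlonglongrightarrow> 0"
  shows "wconv u x"
  unfolding wconv_def
proof
  fix f assume f: "f \<in> dual"
  obtain C where C: "0 < C" "\<And>x. \<bar>f x\<bar> \<le> C * N x" using dual_bound[OF f] by blast
  have "(\<lambda>n. f (u n) - f x) \<longlonglongrightarrow> 0"
  proof (rule Lim_null_comparison)
    show "eventually (\<lambda>n. norm (f (u n) - f x) \<le> C * N (u n - x)) sequentially"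
      using C(2)[of "u _ - x"] by (simp add: linear_diff[OF dual_linear[OF f]])
    show "(\<lambda>n. C * N (u n - x)) \<longlonglongrightarrow> 0" using tendsto_mult_left[OF assms, of C] by simp
  qed
  then show "(\<lambda>n. f (u n)) \<longlonglongrightarrow> f x" by (simp add: LIM_zero_iff)
qed

text \<open>The differences \<open>c - d\<close> form a convex set on which the norm is at least
  \<open>e\<close>, so \<open>mazur_orlicz\<close> applies. The functional has norm at most 1 and
  the gap is the full \<open>e\<close>; \<open>convex_hulls_near\<close> depends on this
  uniformity.\<close>

lemma separation:
  assumes C: "convex C" and D: "convex D" and e: "\<And>c d. c \<in> C \<Longrightarrow> d \<in> D \<Longrightarrow> e \<le> N (c - d)"
  obtains f where "f \<in> dual_ball" "\<And>c d. c \<in> C \<Longrightarrow> d \<in> D \<Longrightarrow> f d + e \<le> f c"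
proof -
  have "convex {c - d |c d. c \<in> C \<and> d \<in> D}"
  proof -
    have "{c - d |c d. c \<in> C \<and> d \<in> D} = (\<Union>x\<in>C. \<Union>y\<in>D. {x - y})" by auto
    then show ?thesis using convex_differences[OF C D] by (simp only:)
  qed
  moreover have "e \<le> N x" if "x \<in> {c - d |c d. c \<in> C \<and> d \<in> D}" for x
    using that by (elim CollectE exE conjE) (simp only: e)
  ultimately obtain f where f: "linear f" "\<And>x. f x \<le> N x"
      "\<And>x. x \<in> {c - d |c d. c \<in> C \<and> d \<in> D} \<Longrightarrow> e \<le> f x"
    using mazur_orlicz[OF sublinear_N, of "{c - d |c d. c \<in> C \<and> d \<in> D}" e] by blast
  have "f d + e \<le> f c" if "c \<in> C" "d \<in> D" for c d
  proof -
    have "e \<le> f (c - d)" using that by (intro f(3)) auto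
    then show ?thesis by (simp add: linear_diff[OF f(1)])
  qed
  then show thesis using that dual_ballI[OF f(1,2)] by blast
qed

lemma norming:
  obtains f where "f \<in> dual_ball" "f x = N x"
proof -
  obtain f where f: "f \<in> dual_ball" "\<And>c d. c \<in> {x} \<Longrightarrow> d \<in> {0} \<Longrightarrow> f d + N x \<le> f c"
    by (rule separation[of "{x}" "{0}" "N x"]) auto
  have "N x \<le> f x" using f(2)[of x 0] linear_0[OF dual_ball_linear[OF f(1)]] by simp
  then show thesis using that[OF f(1)] dual_ball_le[OF f(1), of x] by simp
qed

text \<open>A point outside \<open>S\<close> has some positive distance \<open>e\<close> from it,
  and the gap \<open>e\<close> of a separating functional persists in the limit.\<close>

lemma mazur:
  assumes "convex S" "nclosed S" "\<And>n. u n \<in> S" "wconv u x"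
  shows "x \<in> S"
proof (rule ccontr)
  assume "x \<notin> S"
  then obtain e where e: "0 < e" "\<And>s. s \<in> S \<Longrightarrow> e \<le> N (x - s)"
    using assms(2) unfolding nclosed_def by (meson not_le)
  obtain f where f: "f \<in> dual_ball" "\<And>s. s \<in> S \<Longrightarrow> f s + e \<le> f x"
  proof (rule separation[of "{x}" S e])
    show "e \<le> N (c - d)" if "c \<in> {x}" "d \<in> S" for c d using that e(2) by simp
  qed (use assms(1) in auto)
  have "(\<lambda>n. f (u n)) \<longlonglongrightarrow> f x" using assms(4) f(1) by (intro wconv_dual dual_ball_subset)
  then have "f x \<le> f x - e"
    using f(2)[OF assms(3)] by (intro LIMSEQ_le_const2) (auto simp: algebra_simps)
  then show False using e(1) by simp
qed

lemma wconv_unique: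
  assumes "wconv u x" "wconv u y"
  shows "x = y"
proof -
  obtain f where f: "f \<in> dual_ball" "f (x - y) = N (x - y)" using norming by blast
  then have "f x = f y"
    using assms LIMSEQ_unique wconv_dual dual_ball_subset by blast
  then have "N (x - y) = 0" using f linear_diff[OF dual_ball_linear[OF f(1)]] by simp
  then show ?thesis by (simp add: N_eq_0_iff)
qed

section \<open>Norm closures, separable convex sets and norming sequences\<close>

lemma nclosed_ncl: "nclosed (ncl D)"
  unfolding nclosed_def ncl_def
proof (intro allI impI CollectI)
  fix x and e :: real assume x: "\<forall>e>0. \<exists>s\<in>{x. \<forall>e>0. \<exists>d\<in>D. N (x - d) < e}. N (x - s) < e" and "0 < e"
  then have "0 < e / 2" by simp
  then obtain s where s: "\<forall>e>0. \<exists>d\<in>D. N (s - d) < e" "N (x - s) < e / 2" using x by blast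
  then obtain d where "d \<in> D" "N (s - d) < e / 2" using \<open>0 < e / 2\<close> by blast
  then show "\<exists>d\<in>D. N (x - d) < e" using s(2) N_diff_triangle[of x d s] by force
qed

lemma subset_ncl: "D \<subseteq> ncl D"
  unfolding ncl_def by force

lemma ncl_minimal: "D \<subseteq> S \<Longrightarrow> nclosed S \<Longrightarrow> ncl D \<subseteq> S"
  unfolding ncl_def nclosed_def by blast

text \<open>Rational convex combinations are dense in the real ones.\<close>

lemma convex_ncl:
  assumes D: "\<And>a b t. a \<in> D \<Longrightarrow> b \<in> D \<Longrightarrow> t \<in> \<rat> \<Longrightarrow> 0 \<le> t \<Longrightarrow> t \<le> 1 \<Longrightarrow> (1 - t) *\<^sub>R a + t *\<^sub>R b \<in> D"
  shows "convex (ncl D)"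
proof (rule convexI)
  fix x y and s t :: real
  assume xy: "x \<in> ncl D" "y \<in> ncl D" and st: "0 \<le> s" "0 \<le> t" "s + t = 1"
  show "s *\<^sub>R x + t *\<^sub>R y \<in> ncl D"
    unfolding ncl_def
  proof (safe)
    fix e :: real assume e: "0 < e"
    then have e2: "0 < e / 2" by simp
    obtain a b where ab: "a \<in> D" "N (x - a) < e / 2" "b \<in> D" "N (y - b) < e / 2"
      using xy e2 unfolding ncl_def by blast
    \<comment> \<open>Adding 1 keeps \<open>K\<close> positive when \<open>a = b\<close>; replacing
      \<open>t\<close> by \<open>q\<close> then costs less than \<open>e / 2\<close>.\<close>
    define K where "K = N (a - b) + 1"
    have K: "0 < K" by (simp add: K_def add_nonneg_pos)
    \<comment> \<open>The rational is taken just above \<open>t\<close>, except at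
      \<open>t = 1\<close>, where this would leave the unit interval.\<close>
    obtain q where q: "q \<in> \<rat>" "0 \<le> q" "q \<le> 1" "\<bar>q - t\<bar> < e / (2 * K)"
    proof (cases "t = 1")
      case True
      then show thesis using that[of 1] e K by simp
    next
      case False
      then have "t < min 1 (t + e / (2 * K))" using st e K by simp
      then obtain q where "q \<in> \<rat>" "t < q" "q < min 1 (t + e / (2 * K))" using Rats_dense_in_real by blast
      then show thesis using that[of q] st by auto
    qed
    define d where "d = (1 - q) *\<^sub>R a + q *\<^sub>R b"
    have "s *\<^sub>R x + t *\<^sub>R y - d = (s *\<^sub>R (x - a) + t *\<^sub>R (y - b)) + (q - t) *\<^sub>R (a - b)"
      using st(3) by (simp add: d_def algebra_simps scaleR_left_distrib[symmetric])
    then have "N (s *\<^sub>R x + t *\<^sub>R y - d) \<le> N (s *\<^sub>R (x - a)) + N (t *\<^sub>R (y - b)) + N ((q - t) *\<^sub>R (a - b))"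
      using N_triangle[of "s *\<^sub>R (x - a) + t *\<^sub>R (y - b)" "(q - t) *\<^sub>R (a - b)"]
        N_triangle[of "s *\<^sub>R (x - a)" "t *\<^sub>R (y - b)"] by simp
    also have "\<dots> = s * N (x - a) + t * N (y - b) + \<bar>q - t\<bar> * N (a - b)"
      using st by (simp add: N_scale)
    also have "\<dots> < e"
    proof -
      have "s * N (x - a) + t * N (y - b) \<le> s * (e / 2) + t * (e / 2)"
        using ab st by (intro add_mono mult_left_mono) auto
      also have "\<dots> = e / 2" using st(3) by (simp add: distrib_right[symmetric] del: distrib_right)
      finally have 1: "s * N (x - a) + t * N (y - b) \<le> e / 2" .
      have "\<bar>q - t\<bar> * N (a - b) \<le> \<bar>q - t\<bar> * K" by (intro mult_left_mono) (auto simp: K_def)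
      also have "\<dots> < e / (2 * K) * K" using q(4) K by (intro mult_strict_right_mono)
      also have "\<dots> = e / 2" using K by simp
      finally show ?thesis using 1 by simp
    qed
    finally show "\<exists>d\<in>D. N (s *\<^sub>R x + t *\<^sub>R y - d) < e"
      using D[OF ab(1,3) q(1-3)] by (auto simp: d_def)
  qed
qed

text \<open>Closing \<open>D0\<close> repeatedly under \<open>T\<close> and rational convex
  combinations preserves countability. That \<open>T\<close> also maps the closure into itself is
  left to \<open>weak_fixed_point\<close>, where continuity is available.\<close>

lemma countable_dense_convex:
  fixes T :: "'a \<Rightarrow> 'a"
  assumes "countable D0" "D0 \<subseteq> S" "convex S" "\<And>x. x \<in> S \<Longrightarrow> T x \<in> S"
  obtains D where "countable D" "D0 \<subseteq> D" "D \<subseteq> S" "\<And>x. x \<in> D \<Longrightarrow> T x \<in> D" "convex (ncl D)"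
proof -
  define step where "step E = E \<union> T ` E \<union>
    (\<lambda>(a, b, t). (1 - t) *\<^sub>R a + t *\<^sub>R b) ` (E \<times> E \<times> (\<rat> \<inter> {0..1}))" for E
  define F where "F n = (step ^^ n) D0" for n
  have FS: "F (Suc n) = step (F n)" for n by (simp add: F_def)
  have mono: "F n \<subseteq> F m" if "n \<le> m" for n m
    using that by (rule lift_Suc_mono_le[of F, rotated]) (auto simp: FS step_def)
  have "countable (F n)" for n
  proof (induction n)
    case 0
    then show ?case using assms(1) by (simp add: F_def)
  next
    case (Suc n)
    have "countable (\<rat> \<inter> {0..1} :: real set)" using countable_rat by (intro countable_Int1)
    with Suc show ?case unfolding FS step_def by (intro countable_Un countable_image countable_SIGMA) auto
  qed
  then have 1: "countable (\<Union>n. F n)" by simp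
  have "F 0 = D0" by (simp add: F_def)
  then have 2: "D0 \<subseteq> (\<Union>n. F n)" by blast
  have "F n \<subseteq> S" for n
  proof (induction n)
    case 0
    then show ?case using assms(2) by (simp add: F_def)
  next
    case (Suc n)
    then show ?case unfolding FS step_def using assms(4)
      by (auto intro!: convexD[OF assms(3)])
  qed
  then have 3: "(\<Union>n. F n) \<subseteq> S" by auto
  have 4: "T x \<in> (\<Union>n. F n)" if xF: "x \<in> (\<Union>n. F n)" for x
  proof -
    obtain n where "x \<in> F n" using xF by blast
    then have "T x \<in> F (Suc n)" by (auto simp: FS step_def)
    then show ?thesis by blast
  qed
  have "convex (ncl (\<Union>n. F n))"
  proof (rule convex_ncl)
    fix a b and t :: real
    assume "a \<in> (\<Union>n. F n)" "b \<in> (\<Union>n. F n)" and t: "t \<in> \<rat>" "0 \<le> t" "t \<le> 1"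
    then obtain n m where "a \<in> F n" "b \<in> F m" by blast
    then have "a \<in> F (max n m)" "b \<in> F (max n m)" using mono by (meson max.cobounded1 max.cobounded2 subsetD)+
    then have "(1 - t) *\<^sub>R a + t *\<^sub>R b \<in> F (Suc (max n m))"
      using t unfolding FS step_def by (intro UnI2 image_eqI[of _ _ "(a, b, t)"]) auto
    then show "(1 - t) *\<^sub>R a + t *\<^sub>R b \<in> (\<Union>n. F n)" by blast
  qed
  with 1 2 3 4 show thesis by (rule that)
qed

text \<open>For each pair in \<open>D\<close> a functional attaining the norm of the difference is
  chosen; all have norm at most 1, so the estimate passes to the closure. The form with a bound
  \<open>e\<close>, stronger than separation of points, lets \<open>krein_cluster\<close> recognise
  a Cauchy sequence.\<close>

lemma norming_sequence:
  assumes "countable D"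
  obtains f :: "nat \<Rightarrow> 'a \<Rightarrow> real" where "\<And>j. f j \<in> dual_ball"
    "\<And>x y e. x \<in> ncl D \<Longrightarrow> y \<in> ncl D \<Longrightarrow> (\<And>j. \<bar>f j (x - y)\<bar> \<le> e) \<Longrightarrow> N (x - y) \<le> e"
proof (cases "D = {}")
  case True
  then have "ncl D = {}" unfolding ncl_def by (auto intro: exI[of _ 1])
  moreover obtain g where "g \<in> dual_ball" using norming by blast
  ultimately show thesis using that[of "\<lambda>_. g"] by simp
next
  case False
  define g where "g z = (SOME h. h \<in> dual_ball \<and> h z = N z)" for z
  have g: "g z \<in> dual_ball" "g z z = N z" for z
    unfolding g_def using someI_ex[of "\<lambda>h. h \<in> dual_ball \<and> h z = N z"] norming[of z] by blast+
  define E where "E = (\<lambda>(a, b). g (a - b)) ` (D \<times> D)"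
  have "countable E" "E \<noteq> {}" using assms False by (auto simp: E_def)
  then have ran: "range (from_nat_into E) = E" by (rule range_from_nat_into[rotated])
  show thesis
  proof (rule that[of "from_nat_into E"])
    show "from_nat_into E j \<in> dual_ball" for j
      using ran g(1) unfolding E_def by (smt (verit) imageE rangeI split_beta)
    fix x y e assume x: "x \<in> ncl D" and y: "y \<in> ncl D" and le: "\<And>j. \<bar>from_nat_into E j (x - y)\<bar> \<le> e"
    show "N (x - y) \<le> e"
    proof (rule field_le_epsilon)
      fix d :: real assume "0 < d"
      \<comment> \<open>Both points are approximated, with an error of \<open>d / 2\<close> for
        their difference, and this error enters twice: in the norm and under the functional.\<close>
      then have d: "0 < d / 4" by simp
      obtain a b where ab: "a \<in> D" "b \<in> D" "N (x - a) < d / 4" "N (y - b) < d / 4"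
        using x y d unfolding ncl_def by blast
      have "g (a - b) \<in> E" using ab by (auto simp: E_def)
      then obtain j where j: "from_nat_into E j = g (a - b)" using ran by (metis imageE)
      have "N ((x - y) - (a - b)) \<le> N (x - a) + N (y - b)"
        using N_triangle[of "x - a" "- (y - b)"] N_minus[of "y - b"] by (simp add: algebra_simps)
      then have near: "N ((x - y) - (a - b)) \<le> d / 2" using ab by simp
      have "N (x - y) \<le> N ((x - y) - (a - b)) + N (a - b)"
        using N_triangle[of "(x - y) - (a - b)" "a - b"] by simp
      also have "N (a - b) = g (a - b) (x - y) - g (a - b) ((x - y) - (a - b))"
        using g(2)[of "a - b"] linear_diff[OF dual_ball_linear[OF g(1)[of "a - b"]]] by simp
      also have "\<dots> \<le> e + N ((x - y) - (a - b))"
        using le[of j] dual_ball_le[OF g(1)[of "a - b"], of "(x - y) - (a - b)"] unfolding j by linarith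
      finally show "N (x - y) \<le> e + d" using near by simp
    qed
  qed
qed

text \<open>A closing argument shared by the theorems of Eberlein--Smulian and Krein: once every
  subsequence has some cluster value in \<open>S\<close>, the countably many \<open>f j\<close> force all these values to
  coincide.\<close>

lemma wconv_subseq_if_cluster:
  fixes f :: "nat \<Rightarrow> 'a \<Rightarrow> real"
  assumes f: "\<And>j. f j \<in> dual_ball"
    and sep: "\<And>x y. x \<in> S \<Longrightarrow> y \<in> S \<Longrightarrow> (\<And>j. f j x = f j y) \<Longrightarrow> x = y"
    and bd: "\<And>g. g \<in> dual \<Longrightarrow> \<exists>R. \<forall>n. \<bar>g (u n)\<bar> \<le> R"
    and cl: "\<And>r g c b. strict_mono r \<Longrightarrow> g \<in> dual \<Longrightarrow> (\<And>j. (\<lambda>n. f j (u (r n))) \<longlonglongrightarrow> c j) \<Longrightarrow>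
               (\<lambda>n. g (u (r n))) \<longlonglongrightarrow> b \<Longrightarrow> \<exists>x\<in>S. (\<forall>j. f j x = c j) \<and> g x = b"
  shows "\<exists>r x. strict_mono (r :: nat \<Rightarrow> nat) \<and> x \<in> S \<and> wconv (\<lambda>n. u (r n)) x"
proof -
  have "\<exists>R. \<forall>j n. \<bar>f j (u n)\<bar> \<le> R j"
    using bd[OF dual_ball_subset[OF f]] by metis
  then obtain r :: "nat \<Rightarrow> nat" where r: "strict_mono r" "\<And>j. convergent (\<lambda>n. f j (u (r n)))"
    using diagonal_convergent_subseq[of "\<lambda>j n. f j (u n)"] by metis
  then obtain c where c: "\<And>j. (\<lambda>n. f j (u (r n))) \<longlonglongrightarrow> c j"
    unfolding convergent_def by metis
  obtain x where x: "x \<in> S" "\<And>j. f j x = c j"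
    using cl[OF r(1) dual_ball_subset[OF f] c c] by blast
  have "wconv (\<lambda>n. u (r n)) x"
    unfolding wconv_def
  proof (intro ballI tendsto_if_subseqs)
    fix g and s :: "nat \<Rightarrow> nat" assume g: "g \<in> dual" and s: "strict_mono s"
    obtain R where R: "\<And>n. \<bar>g (u n)\<bar> \<le> R" using bd[OF g] by blast
    obtain q :: "nat \<Rightarrow> nat" where q: "strict_mono q" "convergent (\<lambda>n. g (u (r (s (q n)))))"
      using diagonal_convergent_subseq[of "\<lambda>_ n. g (u (r (s n)))" "\<lambda>_. R"] R by auto
    then obtain b where b: "(\<lambda>n. g (u (r (s (q n))))) \<longlonglongrightarrow> b" by (auto simp: convergent_def)
    have sq: "strict_mono (\<lambda>n. s (q n))" and rsq: "strict_mono (\<lambda>n. r (s (q n)))"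
      using r(1) s q(1) by (auto simp: strict_mono_def)
    have "(\<lambda>n. f j (u (r (s (q n))))) \<longlonglongrightarrow> c j" for j
      using LIMSEQ_subseq_LIMSEQ[OF c sq] by (simp add: o_def)
    then obtain y where y: "y \<in> S" "\<And>j. f j y = c j" "g y = b"
      using cl[OF rsq g _ b] by blast
    have "y = x" using sep[OF y(1) x(1)] y(2) x(2) by simp
    then show "\<exists>q. strict_mono q \<and> (\<lambda>n. g (u (r (s (q n))))) \<longlonglongrightarrow> g x"
      using q(1) b y(3) by auto
  qed
  with r(1) x(1) show ?thesis by blast
qed

end

section \<open>The theorems of Eberlein--Smulian and Krein for sequences\<close>

context norm_function
begin

text \<open>The hypothesis treats one functional at a time and is implied by a weak cluster point of
  every subsequence. It suffices because, along a subsequence on which a functional converges, its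
  value at the cluster point must be the limit.\<close>

lemma eberlein_smulian:
  assumes cl: "\<And>r. strict_mono (r :: nat \<Rightarrow> nat) \<Longrightarrow>
    \<exists>x. \<forall>f\<in>dual. \<forall>e>0. \<exists>\<^sub>F n in sequentially. \<bar>f (u (r n)) - f x\<bar> < e"
  shows "\<exists>r x. strict_mono (r :: nat \<Rightarrow> nat) \<and> wconv (\<lambda>n. u (r n)) x"
proof -
  obtain D where D: "countable D" "range u \<subseteq> D" "convex (ncl D)"
    using countable_dense_convex[of "range u" UNIV id] by auto
  have uD: "u n \<in> ncl D" for n using D(2) subset_ncl by blast
  obtain f :: "nat \<Rightarrow> 'a \<Rightarrow> real" where f: "\<And>j. f j \<in> dual_ball"
    and nf: "\<And>x y e. x \<in> ncl D \<Longrightarrow> y \<in> ncl D \<Longrightarrow> (\<And>j. \<bar>f j (x - y)\<bar> \<le> e) \<Longrightarrow> N (x - y) \<le> e"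
    using norming_sequence[OF D(1)] by metis
  have "\<exists>r x. strict_mono (r :: nat \<Rightarrow> nat) \<and> x \<in> ncl D \<and> wconv (\<lambda>n. u (r n)) x"
  proof (rule wconv_subseq_if_cluster[OF f])
    fix x y assume "x \<in> ncl D" "y \<in> ncl D" "\<And>j. f j x = f j y"
    then have "N (x - y) \<le> 0" by (intro nf) (auto simp: linear_diff[OF dual_ball_linear[OF f]])
    then have "N (x - y) = 0" using N_nonneg[of "x - y"] by linarith
    then show "x = y" by (simp add: N_eq_0_iff)
  next
    fix g assume g: "g \<in> dual"
    \<comment> \<open>Otherwise some subsequence has a \<open>k\<close>-th value under
      \<open>g\<close> of modulus above \<open>k\<close>, which excludes a cluster value.\<close>
    show "\<exists>R. \<forall>n. \<bar>g (u n)\<bar> \<le> R"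
    proof (rule ccontr)
      assume unb: "\<not> ?thesis"
      have "\<exists>n\<ge>m. real m < \<bar>g (u n)\<bar>" for m
      proof (rule ccontr)
        assume "\<not> ?thesis"
        then have large: "\<bar>g (u n)\<bar> \<le> real m" if "m \<le> n" for n using that by (auto simp: not_less)
        have "\<bar>g (u n)\<bar> \<le> real m + (\<Sum>k<m. \<bar>g (u k)\<bar>)" for n
        proof (cases "m \<le> n")
          case True
          then show ?thesis by (intro add_increasing2 sum_nonneg large) auto
        next
          case False
          then show ?thesis by (intro add_increasing member_le_sum) auto
        qed
        then show False using unb by blast
      qed
      then have "\<exists>r :: nat \<Rightarrow> nat. \<forall>k. real k < \<bar>g (u (r k))\<bar> \<and> r k < r (Suc k)"
      proof (intro dependent_nat_choice)
        assume a: "\<And>m. \<exists>n\<ge>m. real m < \<bar>g (u n)\<bar>"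
        then show "\<exists>x. real 0 < \<bar>g (u x)\<bar>" by blast
        fix x k
        obtain n where "max (Suc x) (Suc k) \<le> n" "real (max (Suc x) (Suc k)) < \<bar>g (u n)\<bar>" using a by blast
        then show "\<exists>y. real (Suc k) < \<bar>g (u y)\<bar> \<and> x < y" by (intro exI[of _ n]) auto
      qed
      then obtain r :: "nat \<Rightarrow> nat" where r: "strict_mono r" "\<And>k. real k < \<bar>g (u (r k))\<bar>"
        by (auto simp: strict_mono_Suc_iff)
      obtain x where "\<exists>\<^sub>F n in sequentially. \<bar>g (u (r n)) - g x\<bar> < 1"
        using cl[OF r(1)] g zero_less_one by blast
      moreover have "\<forall>\<^sub>F n in sequentially. \<bar>g x\<bar> + 1 < real n"
        by real_asymp
      ultimately have "\<exists>\<^sub>F n in sequentially. \<bar>g x\<bar> + 1 < real n \<and> \<bar>g (u (r n)) - g x\<bar> < 1"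
        by (rule frequently_eventually_conj)
      then obtain n where "\<bar>g (u (r n)) - g x\<bar> < 1" "\<bar>g x\<bar> + 1 < real n" by (auto dest: frequently_ex)
      then show False using r(2)[of n] by linarith
    qed
  next
    fix r g c b
    assume r: "strict_mono (r :: nat \<Rightarrow> nat)" and g: "g \<in> dual"
      and c: "\<And>j. (\<lambda>n. f j (u (r n))) \<longlonglongrightarrow> c j" and b: "(\<lambda>n. g (u (r n))) \<longlonglongrightarrow> b"
    obtain x where x: "\<And>f e. f \<in> dual \<Longrightarrow> 0 < e \<Longrightarrow> \<exists>\<^sub>F n in sequentially. \<bar>f (u (r n)) - f x\<bar> < e"
      using cl[OF r] by blast
    have lim: "h x = l" if h: "h \<in> dual" "(\<lambda>n. h (u (r n))) \<longlonglongrightarrow> l" for h l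
    proof (rule ccontr)
      assume "h x \<noteq> l"
      then have e: "0 < \<bar>h x - l\<bar> / 2" by simp
      then have "\<forall>\<^sub>F n in sequentially. \<bar>h (u (r n)) - l\<bar> < \<bar>h x - l\<bar> / 2"
        using tendstoD[OF h(2) e] by (simp add: dist_real_def)
      from frequently_eventually_conj[OF x[OF h(1) e] this]
      obtain n where "\<bar>h (u (r n)) - h x\<bar> < \<bar>h x - l\<bar> / 2" "\<bar>h (u (r n)) - l\<bar> < \<bar>h x - l\<bar> / 2"
        by (auto dest: frequently_ex)
      then show False by (simp add: abs_if split: if_splits)
    qed
    \<comment> \<open>A functional separating \<open>x\<close> from \<open>ncl D\<close> would keep
      its values on the sequence at distance \<open>e\<close> from its value at
      \<open>x\<close>.\<close>
    have "x \<in> ncl D"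
    proof (rule ccontr)
      assume "x \<notin> ncl D"
      then obtain e where e: "0 < e" "\<And>s. s \<in> ncl D \<Longrightarrow> e \<le> N (x - s)"
        using nclosed_ncl[of D] unfolding nclosed_def by (meson not_le)
      obtain h where h: "h \<in> dual_ball" "\<And>s. s \<in> ncl D \<Longrightarrow> h s + e \<le> h x"
      proof (rule separation[of "{x}" "ncl D" e])
        show "e \<le> N (c - d)" if "c \<in> {x}" "d \<in> ncl D" for c d using that e(2) by simp
      qed (use D(3) in auto)
      obtain n where "\<bar>h (u (r n)) - h x\<bar> < e"
        using x[OF dual_ball_subset[OF h(1)] e(1)] by (auto dest: frequently_ex)
      then show False using h(2)[OF uD[of "r n"]] by linarith
    qed
    then show "\<exists>x\<in>ncl D. (\<forall>j. f j x = c j) \<and> g x = b"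
      using lim[OF dual_ball_subset[OF f] c] lim[OF g b] by blast
  qed
  then show ?thesis by blast
qed

end

text \<open>Each block is chosen to exhaust the tail union up to \<open>\<eta> / 2 ^ (j + 2)\<close>, so every later
  block is almost contained in it; countable additivity is not needed.\<close>

lemma finitely_additive_blocks:
  fixes \<mu> :: "'b set \<Rightarrow> real" and E :: "nat \<Rightarrow> 'b set"
  assumes add: "\<And>A B. A \<inter> B = {} \<Longrightarrow> \<mu> (A \<union> B) = \<mu> A + \<mu> B"
    and nonneg: "\<And>A. 0 \<le> \<mu> A" and le1: "\<And>A. \<mu> A \<le> 1"
    and \<eta>: "0 < \<eta>" "\<And>l. \<eta> \<le> \<mu> (E l)"
  shows "\<exists>n :: nat \<Rightarrow> nat. strict_mono n \<and> (\<forall>r. \<exists>x. \<forall>j\<le>r. \<exists>l\<in>{n j..<n (Suc j)}. x \<in> E l)"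
proof -
  define U where "U a b = (\<Union>l\<in>{a..<b}. E l)" for a b
  define s where "s a = (SUP b. \<mu> (U a b))" for a
  have mono: "\<mu> A \<le> \<mu> B" if "A \<subseteq> B" for A B
    using add[of A "B - A"] nonneg[of "B - A"] that by (simp add: Un_absorb1)
  have bdd: "bdd_above (range (\<lambda>b. \<mu> (U a b)))" for a using le1 by (intro bdd_aboveI2)
  have s_ge: "\<mu> (U a b) \<le> s a" for a b unfolding s_def using bdd by (intro cSUP_upper) auto
  have "\<exists>n. \<forall>j. True \<and> (n j < n (Suc j) \<and> s (n j) - \<eta> / 2 ^ (j + 2) < \<mu> (U (n j) (n (Suc j))))"
  proof (intro dependent_nat_choice)
    fix a j :: nat
    have "s a - \<eta> / 2 ^ (j + 2) < s a" using \<eta>(1) by simp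
    then obtain b where b: "s a - \<eta> / 2 ^ (j + 2) < \<mu> (U a b)"
      unfolding s_def[of a] using bdd by (auto simp: less_cSUP_iff)
    have "\<mu> (U a b) \<le> \<mu> (U a (max b (Suc a)))" by (rule mono) (auto simp: U_def)
    then show "\<exists>b. True \<and> (a < b \<and> s a - \<eta> / 2 ^ (j + 2) < \<mu> (U a b))"
      using b by (intro exI[of _ "max b (Suc a)"]) auto
  qed auto
  then obtain n :: "nat \<Rightarrow> nat" where n_less: "\<And>j. n j < n (Suc j)"
    and n: "\<And>j. s (n j) - \<eta> / 2 ^ (j + 2) < \<mu> (U (n j) (n (Suc j)))"
    by auto
  have sm: "strict_mono n" using n_less by (simp add: strict_mono_Suc_iff)
  define G where "G j = U (n j) (n (Suc j))" for j
  have diff: "\<mu> (G r - G k) \<le> \<eta> / 2 ^ (k + 2)" if "k < r" for k r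
  proof -
    have "n k \<le> n r" "n (Suc k) \<le> n (Suc r)" "n k \<le> n (Suc k)"
      using that sm by (simp_all add: strict_mono_less_eq)
    then have sub: "G k \<union> (G r - G k) \<subseteq> U (n k) (n (Suc r))"
      unfolding G_def U_def using order_trans less_le_trans by fastforce
    have "\<mu> (G k) + \<mu> (G r - G k) = \<mu> (G k \<union> (G r - G k))" by (rule add[symmetric]) auto
    also have "\<dots> \<le> \<mu> (U (n k) (n (Suc r)))" by (rule mono[OF sub])
    also have "\<dots> \<le> s (n k)" by (rule s_ge)
    finally show ?thesis using n[of k] by (simp add: G_def)
  qed
  \<comment> \<open>Induction on \<open>k\<close> for fixed \<open>r\<close>: \<open>G r\<close>
    contains \<open>E (n r)\<close>, hence has mass at least \<open>\<eta>\<close>, and intersecting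
    with \<open>G k\<close> loses at most the mass of \<open>G r - G k\<close>.\<close>
  have lower: "\<eta> - (\<Sum>j<k. \<eta> / 2 ^ (j + 2)) \<le> \<mu> (G r \<inter> (\<Inter>j<k. G j))" if "k \<le> r" for k r
    using that
  proof (induction k)
    case 0
    have "E (n r) \<subseteq> G r" using n_less[of r] unfolding G_def U_def by auto
    then show ?case using mono[of "E (n r)" "G r"] \<eta>(2)[of "n r"] by simp
  next
    case (Suc k)
    define X where "X = G r \<inter> (\<Inter>j<k. G j)"
    have "\<mu> X = \<mu> ((X \<inter> G k) \<union> (X - G k))" by (simp add: Int_Diff_Un)
    also have "\<dots> = \<mu> (X \<inter> G k) + \<mu> (X - G k)" by (rule add) auto
    also have "\<mu> (X - G k) \<le> \<mu> (G r - G k)" by (rule mono) (auto simp: X_def)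
    also have "\<dots> \<le> \<eta> / 2 ^ (k + 2)" using Suc.prems by (intro diff) simp
    finally have "\<mu> X - \<eta> / 2 ^ (k + 2) \<le> \<mu> (X \<inter> G k)" by simp
    moreover have "X \<inter> G k = G r \<inter> (\<Inter>j<Suc k. G j)" by (auto simp: X_def less_Suc_eq)
    ultimately show ?case using Suc by (simp add: X_def)
  qed
  \<comment> \<open>The exponent \<open>j + 2\<close> keeps the total loss below
    \<open>\<eta> / 2\<close>, so finite intersections of the \<open>G j\<close> have positive
    mass.\<close>
  have sum: "(\<Sum>j<k. \<eta> / 2 ^ (j + 2)) = \<eta> / 2 - \<eta> / 2 ^ (k + 1)" for k
    by (induction k) (auto simp: field_simps)
  have ne: "(\<Inter>j\<le>r. G j) \<noteq> {}" for r
  proof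
    assume emp: "(\<Inter>j\<le>r. G j) = {}"
    have "G r \<inter> (\<Inter>j<r. G j) = (\<Inter>j\<le>r. G j)" by (auto simp: le_less)
    moreover have "0 < \<eta> - (\<Sum>j<r. \<eta> / 2 ^ (j + 2))"
      unfolding sum using \<eta>(1) by (simp add: add_pos_pos)
    ultimately have "0 < \<mu> {}" using lower[of r r] emp by simp
    moreover have "\<mu> {} = 0" using add[of "{}" "{}"] by simp
    ultimately show False by simp
  qed
  have "\<exists>x. \<forall>j\<le>r. \<exists>l\<in>{n j..<n (Suc j)}. x \<in> E l" for r
  proof -
    obtain x where "x \<in> (\<Inter>j\<le>r. G j)" using ne[of r] by (meson ex_in_conv)
    then show ?thesis unfolding G_def U_def by (intro exI[of _ x]) auto
  qed
  with sm show ?thesis by blast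
qed

section \<open>Exchange of limits on convex hulls\<close>

context norm_function
begin

text \<open>Bounded convergence for a finitely additive measure. Each \<open>u m\<close> is the mean
  of a finitely supported probability \<open>M m\<close> on \<open>K\<close>; \<open>\<mu>\<close>
  is their limit along \<open>U\<close>, and \<open>a l\<close> acts as the integral of
  \<open>h l\<close>. Integrals of at least \<open>\<delta>\<close> force
  \<open>\<mu> (E l) \<ge> \<delta> / (2 * R)\<close>. The block lemma and the weak compactness of
  \<open>K\<close> then yield a point of \<open>S\<close> at which \<open>h l\<close> does not tend
  to 0.\<close>

lemma bounded_convergence:
  fixes h :: "nat \<Rightarrow> 'a \<Rightarrow> real" and U :: "nat filter"
  assumes U: "U \<noteq> bot" "\<And>P. eventually P U \<or> eventually (\<lambda>x. \<not> P x) U"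
    and S: "convex S" "nclosed S" and KS: "K \<subseteq> S"
    and K: "\<And>k :: nat \<Rightarrow> 'a. (\<And>n. k n \<in> K) \<Longrightarrow> \<exists>r x. strict_mono (r :: nat \<Rightarrow> nat) \<and> wconv (\<lambda>n. k (r n)) x"
    and h: "\<And>l. h l \<in> dual" and hR: "0 < R" "\<And>l x. x \<in> K \<Longrightarrow> \<bar>h l x\<bar> \<le> R"
    and h0: "\<And>x. x \<in> S \<Longrightarrow> (\<lambda>l. h l x) \<longlonglongrightarrow> 0"
    and u: "\<And>m. u m \<in> convex hull K"
    and a: "\<And>l. ((\<lambda>m. h l (u m)) \<longlongrightarrow> a l) U"
    and \<delta>: "0 < \<delta>" "\<And>l. \<delta> \<le> a l"
  shows False
proof -
  have "\<forall>m. \<exists>Bw. finite (fst Bw) \<and> fst Bw \<subseteq> K \<and> (\<forall>x\<in>fst Bw. 0 \<le> snd Bw x) \<and>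
      sum (snd Bw) (fst Bw) = 1 \<and> (\<Sum>x\<in>fst Bw. snd Bw x *\<^sub>R x) = u m"
    using u unfolding convex_hull_explicit by fastforce
  from choice[OF this] obtain Bw where Bw: "\<And>m. finite (fst (Bw m)) \<and> fst (Bw m) \<subseteq> K \<and>
      (\<forall>x\<in>fst (Bw m). 0 \<le> snd (Bw m) x) \<and> sum (snd (Bw m)) (fst (Bw m)) = 1 \<and>
      (\<Sum>x\<in>fst (Bw m). snd (Bw m) x *\<^sub>R x) = u m"
    by blast
  define B w where "B m = fst (Bw m)" and "w m = snd (Bw m)" for m
  have B: "finite (B m)" "B m \<subseteq> K" and w: "x \<in> B m \<Longrightarrow> 0 \<le> w m x"
    "sum (w m) (B m) = 1" "(\<Sum>x\<in>B m. w m x *\<^sub>R x) = u m" for m x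
    using Bw[of m] by (simp_all add: B_def w_def)
  define M where "M m X = sum (w m) (B m \<inter> X)" for m X
  have M0: "0 \<le> M m X" for m X unfolding M_def using w(1) by (intro sum_nonneg) auto
  have M1: "M m X \<le> 1" for m X
    unfolding M_def w(2)[of m, symmetric] using w(1) B(1) by (intro sum_mono2) auto
  have Madd: "M m (X \<union> Y) = M m X + M m Y" if "X \<inter> Y = {}" for m X Y
    unfolding M_def Int_Un_distrib using B(1) that by (intro sum.union_disjoint) auto
  have "\<exists>l. ((\<lambda>m. M m X) \<longlongrightarrow> l) U" for X
  proof -
    have "\<bar>M m X\<bar> \<le> 1" for m using M0[of m X] M1[of m X] by simp
    then show ?thesis by (rule bounded_tendsto_ultrafilter[OF U])
  qed
  then have "\<exists>\<mu>. \<forall>X. ((\<lambda>m. M m X) \<longlongrightarrow> \<mu> X) U" by (intro choice allI)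
  then obtain \<mu> where \<mu>: "\<And>X. ((\<lambda>m. M m X) \<longlongrightarrow> \<mu> X) U" by blast
  define E where "E l = {x \<in> K. \<delta> / 2 \<le> h l x}" for l
  \<comment> \<open>Markov's inequality: on \<open>K\<close> the functional \<open>h l\<close> is at
    most \<open>R\<close> on \<open>E l\<close> and at most \<open>\<delta> / 2\<close>
    elsewhere.\<close>
  have hM: "h l (u m) \<le> R * M m (E l) + \<delta> / 2" for l m
  proof -
    have "h l (u m) = (\<Sum>x\<in>B m. w m x * h l x)"
      unfolding w(3)[symmetric]
      by (simp add: linear_sum[OF dual_linear[OF h]] linear_scale[OF dual_linear[OF h]])
    also have "\<dots> \<le> (\<Sum>x\<in>B m. R * (if x \<in> E l then w m x else 0) + \<delta> / 2 * w m x)"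
    proof (rule sum_mono)
      fix x assume x: "x \<in> B m"
      then have "x \<in> K" "0 \<le> w m x" using B(2) w(1) by auto
      show "w m x * h l x \<le> R * (if x \<in> E l then w m x else 0) + \<delta> / 2 * w m x"
      proof (cases "x \<in> E l")
        case True
        have "w m x * h l x \<le> w m x * R"
          using hR(2)[OF \<open>x \<in> K\<close>, of l] \<open>0 \<le> w m x\<close> by (intro mult_left_mono) auto
        then show ?thesis using True \<delta>(1) \<open>0 \<le> w m x\<close> by (simp add: mult.commute add_increasing2)
      next
        case False
        then have "h l x \<le> \<delta> / 2" using \<open>x \<in> K\<close> by (simp add: E_def)
        then have "w m x * h l x \<le> w m x * (\<delta> / 2)" using \<open>0 \<le> w m x\<close> by (intro mult_left_mono)
        then show ?thesis using False by (simp add: mult.commute)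
      qed
    qed
    also have "\<dots> = R * M m (E l) + \<delta> / 2"
      unfolding sum.distrib sum_distrib_left[symmetric] w(2) M_def
      using sum.inter_restrict[OF B(1)[of m], of "w m" "E l"] by simp
    finally show ?thesis .
  qed
  have \<mu>E: "\<delta> / (2 * R) \<le> \<mu> (E l)" for l
  proof -
    have "((\<lambda>m. R * M m (E l) + \<delta> / 2) \<longlongrightarrow> R * \<mu> (E l) + \<delta> / 2) U"
      by (intro tendsto_intros \<mu>)
    then have "a l \<le> R * \<mu> (E l) + \<delta> / 2"
      by (rule tendsto_le[OF U(1) _ a]) (simp add: hM)
    then have "\<delta> / 2 \<le> R * \<mu> (E l)" using \<delta>(2)[of l] by simp
    then show ?thesis using hR(1) by (simp add: field_simps)
  qed
  have \<mu>add: "\<mu> (A \<union> C) = \<mu> A + \<mu> C" if "A \<inter> C = {}" for A C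
  proof (rule tendsto_unique[OF U(1) \<mu>[of "A \<union> C"]])
    show "((\<lambda>m. M m (A \<union> C)) \<longlongrightarrow> \<mu> A + \<mu> C) U"
      unfolding Madd[OF that] by (intro tendsto_add \<mu>)
  qed
  have \<mu>0: "0 \<le> \<mu> A" for A
    by (rule tendsto_lowerbound[OF \<mu> _ U(1)]) (simp add: M0)
  have \<mu>1: "\<mu> A \<le> 1" for A
    by (rule tendsto_upperbound[OF \<mu> _ U(1)]) (simp add: M1)
  have pos: "0 < \<delta> / (2 * R)" using \<delta>(1) hR(1) by simp
  have "\<exists>n :: nat \<Rightarrow> nat. strict_mono n \<and> (\<forall>r. \<exists>x. \<forall>j\<le>r. \<exists>l\<in>{n j..<n (Suc j)}. x \<in> E l)"
    by (rule finitely_additive_blocks[of \<mu>, OF \<mu>add \<mu>0 \<mu>1 pos \<mu>E])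
  then obtain n :: "nat \<Rightarrow> nat" where n: "strict_mono n"
    and ne: "\<forall>r. \<exists>x. \<forall>j\<le>r. \<exists>l\<in>{n j..<n (Suc j)}. x \<in> E l" by blast
  from choice[OF ne]
  obtain k where k: "\<And>r j. j \<le> r \<Longrightarrow> \<exists>l\<in>{n j..<n (Suc j)}. k r \<in> E l" by blast
  have kK: "k r \<in> K" for r using k[OF order_refl, of r] unfolding E_def by blast
  obtain q x where q: "strict_mono (q :: nat \<Rightarrow> nat)" and x: "wconv (\<lambda>i. k (q i)) x" using K[of k, OF kK] by blast
  have "x \<in> S" by (rule mazur[OF S _ x]) (use kK KS in blast)
  have "\<exists>l\<ge>j. \<delta> / 2 \<le> h l x" for j
  proof (rule ccontr)
    assume "\<not> ?thesis"
    then have less: "h l x < \<delta> / 2" if "j \<le> l" for l using that by (meson not_le)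
    have "j \<le> n j" using n by (rule strict_mono_imp_increasing)
    \<comment> \<open>Block \<open>j\<close> is finite and its indices are at least
      \<open>n j \<ge> j\<close>, so weak convergence makes all its functionals small at once; but
      \<open>k (q i)\<close> lies in some \<open>E l\<close> of this block as soon as
      \<open>j \<le> q i\<close>.\<close>
    then have "\<forall>l\<in>{n j..<n (Suc j)}. \<forall>\<^sub>F i in sequentially. h l (k (q i)) < \<delta> / 2"
      using less by (intro ballI order_tendstoD(2)[OF wconv_dual[OF x h]]) auto
    then have "\<forall>\<^sub>F i in sequentially. \<forall>l\<in>{n j..<n (Suc j)}. h l (k (q i)) < \<delta> / 2"
      by (intro eventually_ball_finite) auto
    then have "\<forall>\<^sub>F i in sequentially. False"
      using eventually_ge_at_top[of j]
    proof eventually_elim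
      case (elim i)
      have "j \<le> q i" using elim(2) strict_mono_imp_increasing[OF q, of i] by linarith
      then show False using k[of j "q i"] elim(1) unfolding E_def by fastforce
    qed
    then show False by simp
  qed
  moreover have "\<forall>\<^sub>F l in sequentially. h l x < \<delta> / 2"
    using \<delta>(1) by (intro order_tendstoD(2)[OF h0[OF \<open>x \<in> S\<close>]]) simp
  ultimately show False unfolding eventually_sequentially by (meson not_le)
qed

text \<open>A double limit argument in the style of Grothendieck. If the hulls stayed at distance
  \<open>e\<close>, separating functionals would have iterated limits along \<open>v\<close>
  differing by at least \<open>e\<close>, whereas \<open>bounded_convergence\<close> forces the two
  orders to agree.\<close>

lemma convex_hulls_near:
  fixes v :: "nat \<Rightarrow> 'a"
  assumes D: "countable D" and cS: "convex (ncl D)" and KS: "K \<subseteq> ncl D"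
    and K: "\<And>k :: nat \<Rightarrow> 'a. (\<And>n. k n \<in> K) \<Longrightarrow> \<exists>r x. strict_mono (r :: nat \<Rightarrow> nat) \<and> wconv (\<lambda>n. k (r n)) x"
    and R: "\<And>x. x \<in> ncl D \<Longrightarrow> N x \<le> R"
    and v: "\<And>m. v m \<in> convex hull K"
    and e: "0 < e"
  shows "\<exists>i. \<forall>M. \<exists>z\<in>convex hull (v ` {M..}). \<exists>y\<in>convex hull (v ` {..i}). N (z - y) < e"
proof (rule ccontr)
  assume "\<not> ?thesis"
  then have "\<forall>i. \<exists>M. \<forall>z\<in>convex hull (v ` {M..}). \<forall>y\<in>convex hull (v ` {..i}). e \<le> N (z - y)"
    by (simp add: not_less)
  then obtain M where M: "\<And>i z y. z \<in> convex hull (v ` {M i..}) \<Longrightarrow> y \<in> convex hull (v ` {..i}) \<Longrightarrow> e \<le> N (z - y)"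
    by metis
  have "\<exists>f\<in>dual_ball. \<forall>m\<ge>M i. \<forall>j\<le>i. f (v j) + e \<le> f (v m)" for i
  proof -
    obtain f where "f \<in> dual_ball"
      "\<And>z y. z \<in> convex hull (v ` {M i..}) \<Longrightarrow> y \<in> convex hull (v ` {..i}) \<Longrightarrow> f y + e \<le> f z"
      by (rule separation[of "convex hull (v ` {M i..})" "convex hull (v ` {..i})" e])
        (auto intro: M)
    moreover have "v m \<in> convex hull (v ` {M i..})" if "M i \<le> m" for m using that by (intro hull_inc) auto
    moreover have "v j \<in> convex hull (v ` {..i})" if "j \<le> i" for j using that by (intro hull_inc) auto
    ultimately show ?thesis by blast
  qed
  then obtain F :: "nat \<Rightarrow> 'a \<Rightarrow> real" where F: "\<And>i. F i \<in> dual_ball" and Fe: "\<And>i m j. M i \<le> m \<Longrightarrow> j \<le> i \<Longrightarrow> F i (v j) + e \<le> F i (v m)"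
    by metis
  have "convex hull K \<subseteq> ncl D" by (rule hull_minimal) fact+
  then have vS: "v m \<in> ncl D" for m using v by (rule subsetD)
  have "D \<noteq> {}"
  proof
    assume "D = {}"
    then have "ncl D = {}" unfolding ncl_def by (auto intro: exI[of _ 1])
    with vS show False by blast
  qed
  \<comment> \<open>Convergence on the countable set \<open>D\<close> extends to its closure because
    the functionals have norm at most 1.\<close>
  obtain s :: "nat \<Rightarrow> nat" where s: "strict_mono s" "\<And>j. convergent (\<lambda>l. F (s l) (from_nat_into D j))"
    using diagonal_convergent_subseq[of "\<lambda>j l. F l (from_nat_into D j)" "\<lambda>j. N (from_nat_into D j)"]
      dual_ball_le[OF F] by blast
  have conv: "convergent (\<lambda>l. F (s l) x)" if x: "x \<in> ncl D" for x
    unfolding Cauchy_convergent_iff[symmetric]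
  proof (rule CauchyI)
    fix d :: real assume "0 < d"
    then have d: "0 < d / 3" by simp
    obtain y where y: "y \<in> D" "N (x - y) < d / 3" using x d unfolding ncl_def by blast
    obtain j where "from_nat_into D j = y" using from_nat_into_surj[OF D y(1)] by blast
    then have "Cauchy (\<lambda>l. F (s l) y)" using s(2) by (auto simp: Cauchy_convergent_iff)
    then obtain L where L: "\<And>k l. L \<le> k \<Longrightarrow> L \<le> l \<Longrightarrow> \<bar>F (s k) y - F (s l) y\<bar> < d / 3"
      using CauchyD[OF _ d] by fastforce
    have near: "\<bar>F i x - F i y\<bar> < d / 3" for i
      using dual_ball_le[OF F[of i], of "x - y"] y(2) linear_diff[OF dual_ball_linear[OF F[of i]]]
      by simp
    have "\<bar>F (s k) x - F (s l) x\<bar> < d" if "L \<le> k" "L \<le> l" for k l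
      using L[OF that] near[of "s k"] near[of "s l"] by linarith
    then show "\<exists>L. \<forall>k\<ge>L. \<forall>l\<ge>L. norm (F (s k) x - F (s l) x) < d" by auto
  qed
  obtain U :: "nat filter" where U: "U \<noteq> bot" "U \<le> sequentially"
      "\<And>P. eventually P U \<or> eventually (\<lambda>x. \<not> P x) U"
    using ex_ultrafilter_le[of sequentially] by auto
  note ultra = bounded_tendsto_ultrafilter[OF U(1,3)]
  \<comment> \<open>Sequential limits are known only on \<open>ncl D\<close>; the ultrafilter
    extends the limit to a linear functional on the whole space, as membership in
    \<open>dual\<close> demands.\<close>
  have "\<exists>l. ((\<lambda>i. F (s i) x) \<longlongrightarrow> l) U" for x
    by (rule ultra) (rule dual_ball_le[OF F])
  then obtain g where g: "\<And>x. ((\<lambda>i. F (s i) x) \<longlongrightarrow> g x) U" by metis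
  have g_dual: "g \<in> dual_ball"
  proof (rule dual_ballI)
    show "linear g"
    proof (rule linearI)
      fix x y
      have "((\<lambda>i. F (s i) x + F (s i) y) \<longlongrightarrow> g x + g y) U" by (intro tendsto_add g)
      then show "g (x + y) = g x + g y"
        using tendsto_unique[OF U(1) g[of "x + y"]] linear_add[OF dual_ball_linear[OF F]] by simp
    next
      fix c x
      have "((\<lambda>i. c * F (s i) x) \<longlongrightarrow> c * g x) U" by (intro tendsto_mult_left g)
      then show "g (c *\<^sub>R x) = c *\<^sub>R g x"
        using tendsto_unique[OF U(1) g[of "c *\<^sub>R x"]] linear_scale[OF dual_ball_linear[OF F]] by simp
    qed
    show "g x \<le> N x" for x
      using dual_ball_le[OF F, of _ x] by (intro tendsto_upperbound[OF g _ U(1)] always_eventually) (auto simp: abs_le_iff)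
  qed
  have gS: "(\<lambda>i. F (s i) x) \<longlonglongrightarrow> g x" if "x \<in> ncl D" for x
  proof -
    obtain l where l: "(\<lambda>i. F (s i) x) \<longlonglongrightarrow> l" using conv[OF \<open>x \<in> ncl D\<close>] by (auto simp: convergent_def)
    have "l = g x" by (rule tendsto_unique[OF U(1) tendsto_mono[OF U(2) l] g])
    with l show ?thesis by simp
  qed
  have bd: "\<bar>f (v m)\<bar> \<le> R" if "f \<in> dual_ball" for f m
    using dual_ball_le[OF that, of "v m"] R[OF vS[of m]] by linarith
  have "\<exists>l. ((\<lambda>m. F (s i) (v m)) \<longlongrightarrow> l) U" for i
    by (rule ultra) (rule bd[OF F])
  then obtain a where a: "\<And>i. ((\<lambda>m. F (s i) (v m)) \<longlongrightarrow> a i) U" by metis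
  obtain b where b: "((\<lambda>m. g (v m)) \<longlongrightarrow> b) U" using ultra[of "\<lambda>m. g (v m)" R] bd[OF g_dual] by blast
  have "\<bar>a i\<bar> \<le> R" for i
    using bd[OF F] by (intro tendsto_upperbound[OF tendsto_rabs[OF a] _ U(1)] always_eventually) auto
  then obtain \<alpha> where \<alpha>: "(a \<longlongrightarrow> \<alpha>) U" using ultra[of a R] by blast
  have ge_a: "F (s i) (v j) + e \<le> a i" if "j \<le> s i" for i j
  proof (rule tendsto_lowerbound[OF a _ U(1)])
    have "\<forall>\<^sub>F m in U. M (s i) \<le> m" using U(2) eventually_ge_at_top filter_leD by blast
    then show "\<forall>\<^sub>F m in U. F (s i) (v j) + e \<le> F (s i) (v m)" by eventually_elim (rule Fe[OF _ that])
  qed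
  \<comment> \<open>Here \<open>\<alpha>\<close> is the limit over \<open>m\<close> first and
    \<open>i\<close> second, and \<open>b\<close> the limit in the opposite order; the separation
    inequality puts them at least \<open>e\<close> apart.\<close>
  have "g (v j) + e \<le> \<alpha>" for j
  proof (rule tendsto_le[OF U(1) \<alpha> tendsto_add[OF g[of "v j"] tendsto_const]])
    have "\<forall>\<^sub>F i in U. j \<le> i" using U(2) eventually_ge_at_top filter_leD by blast
    then show "\<forall>\<^sub>F i in U. F (s i) (v j) + e \<le> a i"
    proof eventually_elim
      case (elim i)
      then show ?case using ge_a strict_mono_imp_increasing[OF s(1), of i] by simp
    qed
  qed
  then have "g (v j) \<le> \<alpha> - e" for j by (simp add: algebra_simps)
  then have "b \<le> \<alpha> - e" by (intro tendsto_upperbound[OF b _ U(1)]) simp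
  then have "b + e / 2 < \<alpha>" using e by simp
  then have evU: "\<forall>\<^sub>F i in U. b + e / 2 < a i" by (rule order_tendstoD(1)[OF \<alpha>])
  \<comment> \<open>\<open>U\<close> is finer than the sequential filter, so its members are
    infinite sets. The subsequence \<open>t\<close> makes the lower bound hold for every index, as
    \<open>bounded_convergence\<close> asks.\<close>
  have "infinite {i. b + e / 2 < a i}"
  proof
    assume "finite {i. b + e / 2 < a i}"
    then have "\<forall>\<^sub>F i in sequentially. \<not> b + e / 2 < a i"
      by (simp add: eventually_cofinite[symmetric] cofinite_eq_sequentially[symmetric] eventually_cofinite)
    then have "\<forall>\<^sub>F i in U. \<not> b + e / 2 < a i" using U(2) filter_leD by blast
    with evU have "\<forall>\<^sub>F i in U. False" by eventually_elim simp
    with U(1) show False by simp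
  qed
  then obtain t :: "nat \<Rightarrow> nat" where t: "strict_mono t" "\<And>l. b + e / 2 < a (t l)"
    using infinite_enumerate[of "{i. b + e / 2 < a i}"] by auto
  define h where "h l x = F (s (t l)) x - g x" for l x
  have h_dual: "h l \<in> dual" for l
    unfolding h_def using F g_dual by (intro dual_diff dual_ball_subset)
  \<comment> \<open>The summand 1 makes the bound strictly positive, as
    \<open>bounded_convergence\<close> requires.\<close>
  have hR: "\<bar>h l x\<bar> \<le> 2 * \<bar>R\<bar> + 1" if "x \<in> K" for l x
  proof -
    have "N x \<le> \<bar>R\<bar>" using R[of x] KS that by auto
    then show ?thesis
      using dual_ball_le[OF F[of "s (t l)"], of x] dual_ball_le[OF g_dual, of x]
      unfolding h_def by linarith
  qed
  have h0: "(\<lambda>l. h l x) \<longlonglongrightarrow> 0" if "x \<in> ncl D" for x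
    unfolding h_def using LIMSEQ_subseq_LIMSEQ[OF gS[OF that] t(1)] by (simp add: o_def LIM_zero)
  have lim: "((\<lambda>m. h l (v m)) \<longlongrightarrow> a (t l) - b) U" for l
    unfolding h_def by (intro tendsto_diff a b)
  have ge: "e / 2 \<le> a (t l) - b" for l using t(2)[of l] by simp
  have R0: "0 < 2 * \<bar>R\<bar> + 1" and e2: "0 < e / 2" using e by auto
  show False
    by (rule bounded_convergence[where h = h and a = "\<lambda>l. a (t l) - b",
        OF U(1,3) cS nclosed_ncl KS K h_dual R0 hR h0 v lim e2 ge])
qed

end

section \<open>Krein's theorem for sequences in a complete space\<close>

locale banach_norm_function = norm_function +
  assumes complete: "(\<And>e. 0 < e \<Longrightarrow> \<exists>M. \<forall>m\<ge>M. \<forall>n\<ge>M. N (u m - u n) < e) \<Longrightarrow>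
    \<exists>x. (\<lambda>n. N (u n - x)) \<longlonglongrightarrow> 0"
begin

lemma nclosed_limit:
  assumes "nclosed S" "\<And>n. u n \<in> S" "(\<lambda>n. N (u n - x)) \<longlonglongrightarrow> 0"
  shows "x \<in> S"
proof -
  have "\<exists>s\<in>S. N (x - s) < e" if "0 < e" for e
  proof -
    have "\<forall>\<^sub>F n in sequentially. N (u n - x) < e" by (rule order_tendstoD(2)[OF assms(3) that])
    then obtain n where "N (u n - x) < e" by (auto simp: eventually_sequentially)
    then show ?thesis using assms(2) N_commute by metis
  qed
  then show ?thesis using assms(1) unfolding nclosed_def by blast
qed

text \<open>Points in hulls of later and later tails of \<open>v\<close> reproduce all existing
  limits along \<open>v\<close>. By \<open>convex_hulls_near\<close> some of them stay within
  \<open>e\<close> of a hull of finitely many terms, which is compact, so a single point has all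
  these limits up to \<open>e\<close> for functionals of norm at most 1. For \<open>e\<close>
  tending to 0 such points form a Cauchy sequence, and completeness gives \<open>x\<close>.\<close>

lemma krein_cluster:
  fixes v :: "nat \<Rightarrow> 'a"
  assumes D: "countable D" and cS: "convex (ncl D)" and KS: "K \<subseteq> ncl D"
    and K: "\<And>k :: nat \<Rightarrow> 'a. (\<And>n. k n \<in> K) \<Longrightarrow> \<exists>r x. strict_mono (r :: nat \<Rightarrow> nat) \<and> wconv (\<lambda>n. k (r n)) x"
    and R: "\<And>x. x \<in> ncl D \<Longrightarrow> N x \<le> R"
    and v: "\<And>m. v m \<in> convex hull K"
    and f: "\<And>j :: nat. f j \<in> dual_ball"
    and nf: "\<And>x y e. x \<in> ncl D \<Longrightarrow> y \<in> ncl D \<Longrightarrow> (\<And>j. \<bar>f j (x - y)\<bar> \<le> e) \<Longrightarrow> N (x - y) \<le> e"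
    and c: "\<And>j. (\<lambda>n. f j (v n)) \<longlonglongrightarrow> c j"
  shows "\<exists>x\<in>ncl D. \<forall>g\<in>dual. \<forall>b. (\<lambda>n. g (v n)) \<longlonglongrightarrow> b \<longrightarrow> g x = b"
proof -
  have "convex hull K \<subseteq> ncl D" by (rule hull_minimal) fact+
  then have vS: "v m \<in> ncl D" for m using v by (rule subsetD)
  have approx: "\<exists>y\<in>ncl D. \<forall>h\<in>dual_ball. \<forall>b. (\<lambda>n. h (v n)) \<longlonglongrightarrow> b \<longrightarrow> \<bar>h y - b\<bar> \<le> e" if e: "0 < e" for e
  proof -
    obtain i z y where z: "\<And>M. z M \<in> convex hull (v ` {M..})"
      and y: "\<And>M. y M \<in> convex hull (v ` {..i})" and zy: "\<And>M. N (z M - y M) < e"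
      using convex_hulls_near[where v = v and e = e, OF D cS KS K R v e] by metis
    define V where "V = v ` {..i}"
    have V: "finite V" "V \<subseteq> ncl D" using vS by (auto simp: V_def)
    have "\<exists>w. (\<forall>x\<in>V. 0 \<le> w x) \<and> sum w V = 1 \<and> (\<Sum>x\<in>V. w x *\<^sub>R x) = y M" for M
      using y[of M] V(1) by (auto simp: V_def[symmetric] convex_hull_finite)
    then obtain w where w: "\<And>M x. x \<in> V \<Longrightarrow> 0 \<le> w M x" "\<And>M. sum (w M) V = 1"
      "\<And>M. (\<Sum>x\<in>V. w M x *\<^sub>R x) = y M" by metis
    obtain U :: "nat filter" where U: "U \<noteq> bot" "U \<le> sequentially"
        "\<And>P. eventually P U \<or> eventually (\<lambda>x. \<not> P x) U"
      using ex_ultrafilter_le[of sequentially] by auto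
    \<comment> \<open>Compactness of the finite hull is used through its barycentric weights, which
      converge along \<open>U\<close>.\<close>
    have "\<exists>l. ((\<lambda>M. w M x) \<longlongrightarrow> l) U" if x: "x \<in> V" for x
    proof -
      have "\<bar>w M x\<bar> \<le> 1" for M
        using member_le_sum[OF x, of "w M"] w(1)[OF x, of M] w(1) w(2)[of M] V(1) by fastforce
      then show ?thesis by (rule bounded_tendsto_ultrafilter[OF U(1,3)])
    qed
    then obtain w' where w': "\<And>x. x \<in> V \<Longrightarrow> ((\<lambda>M. w M x) \<longlongrightarrow> w' x) U" by metis
    define y' where "y' = (\<Sum>x\<in>V. w' x *\<^sub>R x)"
    have w'0: "0 \<le> w' x" if "x \<in> V" for x
      by (rule tendsto_lowerbound[OF w'[OF that] _ U(1)]) (simp add: w(1)[OF that])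
    have "((\<lambda>M. sum (w M) V) \<longlongrightarrow> sum w' V) U" by (intro tendsto_sum w')
    then have w'1: "sum w' V = 1"
      using tendsto_unique[OF U(1) _ tendsto_const[of 1]] by (simp add: w(2))
    have "y' \<in> ncl D"
      unfolding y'_def using V w'0 by (intro convex_sum[OF V(1) cS w'1]) auto
    moreover have "\<bar>h y' - b\<bar> \<le> e" if h: "h \<in> dual_ball" "(\<lambda>n. h (v n)) \<longlonglongrightarrow> b" for h b
    proof -
      note lin = dual_ball_linear[OF h(1)]
      have "((\<lambda>M. \<Sum>x\<in>V. w M x * h x) \<longlongrightarrow> (\<Sum>x\<in>V. w' x * h x)) U"
        by (intro tendsto_sum tendsto_mult w' tendsto_const)
      moreover have "h (y M) = (\<Sum>x\<in>V. w M x * h x)" for M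
        unfolding w(3)[symmetric] by (simp add: linear_sum[OF lin] linear_scale[OF lin])
      moreover have "h y' = (\<Sum>x\<in>V. w' x * h x)"
        unfolding y'_def by (simp add: linear_sum[OF lin] linear_scale[OF lin])
      ultimately have hy: "((\<lambda>M. h (y M)) \<longlongrightarrow> h y') U" by simp
      have "(\<lambda>M. h (z M)) \<longlonglongrightarrow> b"
      proof (rule LIMSEQ_I)
        fix d :: real assume "0 < d"
        then obtain L where L: "\<And>n. L \<le> n \<Longrightarrow> \<bar>h (v n) - b\<bar> < d"
          using LIMSEQ_D[OF h(2)] by (metis real_norm_def)
        have "\<bar>h (z M) - b\<bar> < d" if "L \<le> M" for M
        proof -
          \<comment> \<open>A convex preimage of an interval contains the hull of a tail as soon as
            it contains the tail.\<close>
          have "convex (h -` {b - d<..<b + d})"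
            using lin by (intro convex_linear_vimage) auto
          moreover have "v ` {M..} \<subseteq> h -` {b - d<..<b + d}"
          proof
            fix x assume "x \<in> v ` {M..}"
            then obtain n where "M \<le> n" "x = v n" by auto
            then show "x \<in> h -` {b - d<..<b + d}" using L[of n] \<open>L \<le> M\<close> by (auto simp: abs_less_iff)
          qed
          ultimately have "convex hull (v ` {M..}) \<subseteq> h -` {b - d<..<b + d}" by (intro hull_minimal)
          then show ?thesis using z[of M] by (auto simp: abs_less_iff)
        qed
        then show "\<exists>L. \<forall>M\<ge>L. norm (h (z M) - b) < d" by auto
      qed
      then have hz: "((\<lambda>M. h (z M)) \<longlongrightarrow> b) U" by (rule tendsto_mono[OF U(2)])
      have "\<bar>h (y M) - h (z M)\<bar> \<le> e" for M
        using dual_ball_le[OF h(1), of "z M - y M"] zy[of M] by (simp add: linear_diff[OF lin])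
      then show ?thesis
        by (intro tendsto_upperbound[OF tendsto_rabs[OF tendsto_diff[OF hy hz]] _ U(1)]) simp
    qed
    ultimately show ?thesis by blast
  qed
  have "\<exists>y\<in>ncl D. \<forall>h\<in>dual_ball. \<forall>b. (\<lambda>n. h (v n)) \<longlonglongrightarrow> b \<longrightarrow> \<bar>h y - b\<bar> \<le> 1 / real (Suc k)" for k
    by (rule approx) simp
  then obtain y where yS: "\<And>k. y k \<in> ncl D"
    and y: "\<And>k h b. h \<in> dual_ball \<Longrightarrow> (\<lambda>n. h (v n)) \<longlonglongrightarrow> b \<Longrightarrow> \<bar>h (y k) - b\<bar> \<le> 1 / real (Suc k)"
    by metis
  \<comment> \<open>Both points have \<open>f j\<close>-values close to the common limit
    \<open>c j\<close>, and \<open>nf\<close> turns this into a norm estimate.\<close>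
  have yy: "N (y k - y l) \<le> 1 / real (Suc k) + 1 / real (Suc l)" for k l
  proof (rule nf[OF yS yS])
    show "\<bar>f j (y k - y l)\<bar> \<le> 1 / real (Suc k) + 1 / real (Suc l)" for j
      using y[OF f c, of j k] y[OF f c, of j l] unfolding linear_diff[OF dual_ball_linear[OF f]] by linarith
  qed
  have "\<exists>x. (\<lambda>n. N (y n - x)) \<longlonglongrightarrow> 0"
  proof (rule complete)
    fix e :: real assume e: "0 < e"
    obtain M where M: "1 / real (Suc M) < e / 2"
      using reals_Archimedean[of "e / 2"] e by (auto simp: inverse_eq_divide)
    have "N (y m - y n) < e" if "M \<le> m" "M \<le> n" for m n
    proof -
      have "1 / real (Suc m) \<le> 1 / real (Suc M)" "1 / real (Suc n) \<le> 1 / real (Suc M)"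
        using that by (simp_all add: frac_le)
      then show ?thesis using yy[of m n] M by linarith
    qed
    then show "\<exists>M. \<forall>m\<ge>M. \<forall>n\<ge>M. N (y m - y n) < e" by blast
  qed
  then obtain x where x: "(\<lambda>n. N (y n - x)) \<longlonglongrightarrow> 0" by blast
  have "x \<in> ncl D" by (rule nclosed_limit[OF nclosed_ncl yS x])
  moreover have "g x = b" if g: "g \<in> dual" "(\<lambda>n. g (v n)) \<longlonglongrightarrow> b" for g b
  proof -
    obtain C h where h: "0 < C" "h \<in> dual_ball" "\<And>x. g x = C * h x" using dual_scale_ball[OF g(1)] by blast
    have "(\<lambda>n. C * h (v n) / C) \<longlonglongrightarrow> b / C" using g(2) h(1) by (intro tendsto_divide) (auto simp: h(3))
    then have "(\<lambda>n. h (v n)) \<longlonglongrightarrow> b / C" using h(1) by simp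
    then have le: "\<bar>h (y k) - b / C\<bar> \<le> 1 / real (Suc k)" for k by (rule y[OF h(2)])
    have "(\<lambda>k. h (y k)) \<longlonglongrightarrow> h x" by (rule wconv_dual[OF norm_conv_imp_wconv[OF x] dual_ball_subset[OF h(2)]])
    moreover have "(\<lambda>k. h (y k)) \<longlonglongrightarrow> b / C"
    proof -
      have "(\<lambda>k. h (y k) - b / C) \<longlonglongrightarrow> 0"
        by (rule Lim_null_comparison[where g = "\<lambda>k. 1 / real (Suc k)"])
          (use le LIMSEQ_inverse_real_of_nat in \<open>auto simp: inverse_eq_divide\<close>)
      then show ?thesis by (simp add: LIM_zero_iff)
    qed
    ultimately have "h x = b / C" by (rule LIMSEQ_unique)
    then show ?thesis using h by simp
  qed
  ultimately show ?thesis by blast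
qed

lemma krein:
  fixes v :: "nat \<Rightarrow> 'a"
  assumes D: "countable D" and cS: "convex (ncl D)" and KS: "K \<subseteq> ncl D"
    and K: "\<And>k :: nat \<Rightarrow> 'a. (\<And>n. k n \<in> K) \<Longrightarrow> \<exists>r x. strict_mono (r :: nat \<Rightarrow> nat) \<and> wconv (\<lambda>n. k (r n)) x"
    and R: "\<And>x. x \<in> ncl D \<Longrightarrow> N x \<le> R"
    and v: "\<And>m. v m \<in> convex hull K"
  shows "\<exists>r x. strict_mono (r :: nat \<Rightarrow> nat) \<and> x \<in> ncl D \<and> wconv (\<lambda>n. v (r n)) x"
proof -
  obtain f :: "nat \<Rightarrow> 'a \<Rightarrow> real" where f: "\<And>j. f j \<in> dual_ball"
    and nf: "\<And>x y e. x \<in> ncl D \<Longrightarrow> y \<in> ncl D \<Longrightarrow> (\<And>j. \<bar>f j (x - y)\<bar> \<le> e) \<Longrightarrow> N (x - y) \<le> e"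
    using norming_sequence[OF D(1)] by metis
  have "convex hull K \<subseteq> ncl D" by (rule hull_minimal) fact+
  then have vS: "v m \<in> ncl D" for m using v by (rule subsetD)
  show ?thesis
  proof (rule wconv_subseq_if_cluster[OF f])
    fix x y assume "x \<in> ncl D" "y \<in> ncl D" "\<And>j. f j x = f j y"
    then have "N (x - y) \<le> 0" by (intro nf) (auto simp: linear_diff[OF dual_ball_linear[OF f]])
    then have "N (x - y) = 0" using N_nonneg[of "x - y"] by linarith
    then show "x = y" by (simp add: N_eq_0_iff)
  next
    fix g assume "g \<in> dual"
    then obtain C where C: "0 < C" "\<And>x. \<bar>g x\<bar> \<le> C * N x" using dual_bound by blast
    have "\<bar>g (v n)\<bar> \<le> C * R" for n
      using C(2)[of "v n"] mult_left_mono[OF R[OF vS[of n]], of C] C(1) by linarith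
    then show "\<exists>R. \<forall>n. \<bar>g (v n)\<bar> \<le> R" by blast
  next
    fix r g c b
    assume r: "strict_mono (r :: nat \<Rightarrow> nat)" and g: "g \<in> dual"
      and c: "\<And>j. (\<lambda>n. f j (v (r n))) \<longlonglongrightarrow> c j" and b: "(\<lambda>n. g (v (r n))) \<longlonglongrightarrow> b"
    have "\<exists>x\<in>ncl D. \<forall>g\<in>dual. \<forall>b. (\<lambda>n. g (v (r n))) \<longlonglongrightarrow> b \<longrightarrow> g x = b"
      by (rule krein_cluster[where f = f and c = c, OF D cS KS K R v f nf c])
    then obtain x where x: "x \<in> ncl D" "\<And>g b. g \<in> dual \<Longrightarrow> (\<lambda>n. g (v (r n))) \<longlonglongrightarrow> b \<Longrightarrow> g x = b"
      by blast
    show "\<exists>x\<in>ncl D. (\<forall>j. f j x = c j) \<and> g x = b"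
      using x(1) x(2)[OF dual_ball_subset[OF f] c] x(2)[OF g b] by blast
  qed
qed

end

section \<open>Brouwer's theorem in a cube of arbitrary finite dimension\<close>

text \<open>The dimension \<open>k\<close> will be the size of a net, a variable rather than a type,
  so points are sequences of which the first \<open>k\<close> coordinates count. Kuhn's
  combinatorial lemma gives, in a grid of mesh \<open>1 / real (Suc n)\<close>, a cell in which for
  each coordinate some corner is not moved down by \<open>G\<close> and some corner is not moved up;
  the cells shrink to a fixed point.\<close>

lemma brouwer_cube_seq:
  fixes G :: "(nat \<Rightarrow> real) \<Rightarrow> nat \<Rightarrow> real" and k :: nat
  defines "Q \<equiv> {x. \<forall>i<k. 0 \<le> x i \<and> x i \<le> 1}"
  assumes G: "\<And>x. x \<in> Q \<Longrightarrow> G x \<in> Q"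
    and cont: "\<And>u x i. (\<And>n. u n \<in> Q) \<Longrightarrow> x \<in> Q \<Longrightarrow> (\<And>j. j < k \<Longrightarrow> (\<lambda>n. u n j) \<longlonglongrightarrow> x j) \<Longrightarrow>
                 i < k \<Longrightarrow> (\<lambda>n. G (u n) i) \<longlonglongrightarrow> G x i"
  shows "\<exists>x\<in>Q. \<forall>i<k. G x i = x i"
proof -
  define near where "near n z x \<longleftrightarrow> (\<forall>j<k. \<bar>x j - z j\<bar> \<le> 1 / real (Suc n))" for n and z x :: "nat \<Rightarrow> real"
  have "\<exists>z. (\<forall>j. 0 \<le> z j \<and> z j \<le> 1) \<and>
      (\<forall>i<k. \<exists>x\<in>Q. \<exists>y\<in>Q. near n z x \<and> near n z y \<and> x i \<le> G x i \<and> G y i \<le> y i)" for n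
  proof -
    define p where "p = Suc n"
    define P where "P x = (\<lambda>i. real (x i) / real p)" for x :: "nat \<Rightarrow> nat"
    \<comment> \<open>Kuhn's lemma prescribes label 1 on the face \<open>x i = p\<close>. The first
      test enforces it where \<open>G\<close> fixes the coordinate 1, since the comparison alone
      would give 0 there.\<close>
    define label :: "(nat \<Rightarrow> nat) \<Rightarrow> nat \<Rightarrow> nat"
      where "label x i = (if x i = p then 1 else if P x i \<le> G (P x) i then 0 else 1)" for x i
    have p: "0 < p" by (simp add: p_def)
    have PQ: "P x \<in> Q" if "\<forall>i<k. x i \<le> p" for x
      using that p by (auto simp: Q_def P_def field_simps)
    have lab0: "P x i \<le> G (P x) i" if "label x i = 0" for x i
      using that by (auto simp: label_def split: if_splits)
    have lab1: "G (P x) i \<le> P x i" if "\<forall>i<k. x i \<le> p" "i < k" "label x i = 1" for x i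
    proof (cases "x i = p")
      case True
      then have "P x i = 1" using p by (simp add: P_def)
      then show ?thesis using G[OF PQ[OF that(1)]] that(2) by (simp add: Q_def)
    next
      case False
      then show ?thesis using that(3) by (auto simp: label_def split: if_splits)
    qed
    have 1: "\<forall>x. (\<forall>i<k. x i \<le> p) \<longrightarrow> (\<forall>i<k. label x i = 0 \<or> label x i = 1)"
      by (auto simp: label_def)
    have 2: "\<forall>x. (\<forall>i<k. x i \<le> p) \<longrightarrow> (\<forall>i<k. x i = 0 \<longrightarrow> label x i = 0)"
    proof (intro allI impI)
      fix x i assume "\<forall>i<k. x i \<le> p" "i < k" and 0: "x i = 0"
      then have "0 \<le> G (P x) i" using G[OF PQ] by (auto simp: Q_def)
      then show "label x i = 0" using p 0 by (simp add: label_def P_def)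
    qed
    have 3: "\<forall>x. (\<forall>i<k. x i \<le> p) \<longrightarrow> (\<forall>i<k. x i = p \<longrightarrow> label x i = 1)"
      by (auto simp: label_def)
    obtain q where q: "\<forall>i<k. q i < p" "\<forall>i<k. \<exists>r s. (\<forall>j<k. q j \<le> r j \<and> r j \<le> q j + 1) \<and>
        (\<forall>j<k. q j \<le> s j \<and> s j \<le> q j + 1) \<and> label r i \<noteq> label s i"
      by (rule kuhn_lemma[OF p 1 2 3])
    \<comment> \<open>The value 0 beyond \<open>k\<close> bounds all coordinates, so that the
      diagonal subsequence applies to \<open>z\<close>.\<close>
    define z where "z j = (if j < k then P q j else 0)" for j
    have z01: "0 \<le> z j \<and> z j \<le> 1" for j using q(1) p by (auto simp: z_def P_def field_simps dest: less_imp_le)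
    have corner: "near n z (P r) \<and> P r \<in> Q" "\<forall>j<k. r j \<le> p" if r: "\<forall>j<k. q j \<le> r j \<and> r j \<le> q j + 1" for r
    proof -
      show le: "\<forall>j<k. r j \<le> p" using r q(1) by fastforce
      have "\<bar>P r j - z j\<bar> \<le> 1 / real (Suc n)" if "j < k" for j
      proof -
        have "\<bar>real (r j) - real (q j)\<bar> \<le> 1" using r that by force
        moreover have "P r j - z j = (real (r j) - real (q j)) / real p"
          using that by (simp add: z_def P_def diff_divide_distrib)
        ultimately show ?thesis using p by (simp add: p_def divide_right_mono)
      qed
      then show "near n z (P r) \<and> P r \<in> Q" using PQ[OF le] by (simp add: near_def)
    qed
    have "\<exists>x\<in>Q. \<exists>y\<in>Q. near n z x \<and> near n z y \<and> x i \<le> G x i \<and> G y i \<le> y i" if i: "i < k" for i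
    proof -
      obtain r s where r: "\<forall>j<k. q j \<le> r j \<and> r j \<le> q j + 1"
        and s: "\<forall>j<k. q j \<le> s j \<and> s j \<le> q j + 1" and ne: "label r i \<noteq> label s i"
        using q(2) i by blast
      have "label r i = 0 \<and> label s i = 1 \<or> label s i = 0 \<and> label r i = 1"
        using 1 corner(2)[OF r] corner(2)[OF s] i ne by metis
      then show ?thesis
      proof
        assume "label r i = 0 \<and> label s i = 1"
        then show ?thesis using corner[OF r] corner[OF s] lab0[of r i] lab1[of s i] i by blast
      next
        assume "label s i = 0 \<and> label r i = 1"
        then show ?thesis using corner[OF r] corner[OF s] lab0[of s i] lab1[of r i] i by blast
      qed
    qed
    with z01 show ?thesis by blast
  qed
  then obtain z where z01: "\<And>n j. 0 \<le> z n j \<and> z n j \<le> 1"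
    and ex: "\<And>n i. i < k \<Longrightarrow> \<exists>x\<in>Q. \<exists>y\<in>Q. near n (z n) x \<and> near n (z n) y \<and> x i \<le> G x i \<and> G y i \<le> y i"
    by metis
  obtain r :: "nat \<Rightarrow> nat" where r: "strict_mono r" "\<And>j. convergent (\<lambda>n. z (r n) j)"
    using diagonal_convergent_subseq[of "\<lambda>j n. z n j" "\<lambda>_. 1"] z01 by auto
  then have "\<exists>l. \<forall>j. (\<lambda>n. z (r n) j) \<longlonglongrightarrow> l j" by (intro choice allI) (simp add: convergent_def)
  then obtain l where l: "\<And>j. (\<lambda>n. z (r n) j) \<longlonglongrightarrow> l j" by blast
  have lQ: "l \<in> Q"
    unfolding Q_def using z01
    by (auto intro!: LIMSEQ_le_const[OF l] LIMSEQ_le_const2[OF l])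
  have tends: "(\<lambda>n. u n j) \<longlonglongrightarrow> l j" if u: "\<And>n. near (r n) (z (r n)) (u n)" and j: "j < k" for u j
  proof -
    have "(\<lambda>n. u n j - z (r n) j) \<longlonglongrightarrow> 0"
    proof (rule Lim_null_comparison)
      show "\<forall>\<^sub>F n in sequentially. norm (u n j - z (r n) j) \<le> 1 / real (Suc (r n))"
        using u j by (simp add: near_def)
      show "(\<lambda>n. 1 / real (Suc (r n))) \<longlonglongrightarrow> 0"
        using LIMSEQ_subseq_LIMSEQ[OF LIMSEQ_inverse_real_of_nat r(1)] by (simp add: o_def inverse_eq_divide)
    qed
    from tendsto_add[OF this l[of j]] show ?thesis by simp
  qed
  have "G l i = l i" if i: "i < k" for i
  proof (rule antisym)
    have "\<forall>n. \<exists>y. y \<in> Q \<and> near (r n) (z (r n)) y \<and> G y i \<le> y i" using ex[OF i] by blast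
    from choice[OF this] obtain y where y: "\<And>n. y n \<in> Q" "\<And>n. near (r n) (z (r n)) (y n)" "\<And>n. G (y n) i \<le> y n i"
      by blast
    show "G l i \<le> l i"
      by (rule LIMSEQ_le[OF cont[OF y(1) lQ tends[OF y(2)] i] tends[OF y(2) i]]) (use y(3) in auto)
    have "\<forall>n. \<exists>x. x \<in> Q \<and> near (r n) (z (r n)) x \<and> x i \<le> G x i" using ex[OF i] by blast
    from choice[OF this] obtain x where x: "\<And>n. x n \<in> Q" "\<And>n. near (r n) (z (r n)) (x n)" "\<And>n. x n i \<le> G (x n) i"
      by blast
    show "l i \<le> G l i"
      by (rule LIMSEQ_le[OF tends[OF x(2) i] cont[OF x(1) lQ tends[OF x(2)] i]]) (use x(3) in auto)
  qed
  with lQ show ?thesis by blast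
qed

section \<open>A fixed point theorem for weakly sequentially continuous maps\<close>

context norm_function
begin

lemma wconv_sum:
  assumes "finite I" "\<And>i. i \<in> I \<Longrightarrow> (\<lambda>n. c n i) \<longlonglongrightarrow> d i"
  shows "wconv (\<lambda>n. \<Sum>i\<in>I. c n i *\<^sub>R y i) (\<Sum>i\<in>I. d i *\<^sub>R y i)"
  unfolding wconv_def
proof
  fix f assume f: "f \<in> dual"
  have "(\<lambda>n. \<Sum>i\<in>I. c n i * f (y i)) \<longlonglongrightarrow> (\<Sum>i\<in>I. d i * f (y i))"
    using assms(2) by (intro tendsto_sum tendsto_mult_right)
  then show "(\<lambda>n. f (\<Sum>i\<in>I. c n i *\<^sub>R y i)) \<longlonglongrightarrow> f (\<Sum>i\<in>I. d i *\<^sub>R y i)"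
    by (simp add: linear_sum[OF dual_linear[OF f]] linear_scale[OF dual_linear[OF f]])
qed

text \<open>Points are coded by the integer parts of \<open>f j x / e\<close> for
  \<open>j < m\<close>. Boundedness leaves finitely many codes, and points sharing a code differ by
  less than \<open>e\<close> under each of these functionals.\<close>

lemma finite_functional_net:
  fixes f :: "nat \<Rightarrow> 'a \<Rightarrow> real"
  assumes e: "0 < e" and bd: "\<And>j x. x \<in> K \<Longrightarrow> \<bar>f j x\<bar> \<le> R"
  obtains k and y :: "nat \<Rightarrow> 'a" where "\<And>i. i < k \<Longrightarrow> y i \<in> K"
    "\<And>t. t \<in> K \<Longrightarrow> \<exists>i<k. \<forall>j<m. \<bar>f j t - f j (y i)\<bar> < e"
proof -
  define c where "c x = restrict (\<lambda>j. \<lfloor>f j x / e\<rfloor>) {..<m}" for x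
  have "c ` K \<subseteq> PiE {..<m} (\<lambda>_. {\<lfloor>- R / e\<rfloor>..\<lfloor>R / e\<rfloor>})"
  proof
    fix a assume "a \<in> c ` K"
    then obtain x where x: "x \<in> K" "a = c x" by blast
    have "- R / e \<le> f j x / e \<and> f j x / e \<le> R / e" for j
      using bd[OF x(1), of j] e by (simp add: divide_right_mono abs_le_iff del: divide_minus_left)
    then have "\<lfloor>- R / e\<rfloor> \<le> \<lfloor>f j x / e\<rfloor> \<and> \<lfloor>f j x / e\<rfloor> \<le> \<lfloor>R / e\<rfloor>" for j
      by (intro conjI floor_mono) auto
    then show "a \<in> PiE {..<m} (\<lambda>_. {\<lfloor>- R / e\<rfloor>..\<lfloor>R / e\<rfloor>})"
      unfolding x(2) c_def by (simp add: PiE_iff)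
  qed
  then have "finite (c ` K)" by (rule finite_subset) (simp add: finite_PiE)
  then obtain Y where Y: "Y \<subseteq> K" "finite Y" "c ` K = c ` Y"
    using finite_subset_image[of "c ` K" c K] by auto
  obtain k and y :: "nat \<Rightarrow> 'a" where y: "Y = y ` {i. i < k}"
    using finite_imp_nat_seg_image_inj_on[OF Y(2)] by blast
  show thesis
  proof (rule that[of k y])
    show "y i \<in> K" if "i < k" for i using Y(1) y that by blast
    fix t assume "t \<in> K"
    then obtain i where i: "i < k" "c t = c (y i)" using Y(3) y by blast
    have "\<bar>f j t - f j (y i)\<bar> < e" if "j < m" for j
    proof -
      have "\<lfloor>f j t / e\<rfloor> = \<lfloor>f j (y i) / e\<rfloor>"
        using fun_cong[OF i(2), of j] that by (simp add: c_def)
      then have "\<bar>f j t / e - f j (y i) / e\<bar> < 1" by linarith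
      moreover have "f j t / e - f j (y i) / e = (f j t - f j (y i)) / e" by (simp add: diff_divide_distrib)
      ultimately show ?thesis using e by (simp add: abs_div_pos[symmetric] field_simps)
    qed
    then show "\<exists>i<k. \<forall>j<m. \<bar>f j t - f j (y i)\<bar> < e" using i(1) by blast
  qed
qed

text \<open>Brouwer's theorem is applied to a Schauder projection \<open>W\<close> on the hull of a finite net
  \<open>y\<close>, in barycentric coordinates; \<open>bc\<close> retracts the cube to the simplex.\<close>

lemma approximate_fixed_point:
  fixes f :: "nat \<Rightarrow> 'a \<Rightarrow> real"
  assumes S: "convex S" "S \<noteq> {}" and T: "\<And>x. x \<in> S \<Longrightarrow> T x \<in> S"
    and cont: "\<And>u x. (\<And>n. u n \<in> S) \<Longrightarrow> x \<in> S \<Longrightarrow> wconv u x \<Longrightarrow> wconv (\<lambda>n. T (u n)) (T x)"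
    and f: "\<And>j. f j \<in> dual" and bd: "\<And>j x. x \<in> S \<Longrightarrow> \<bar>f j x\<bar> \<le> R" and e: "0 < e"
  shows "\<exists>x\<in>convex hull (T ` S). \<forall>j<m. \<bar>f j (x - T x)\<bar> \<le> e"
proof -
  have bdT: "\<bar>f j x\<bar> \<le> R" if "x \<in> T ` S" for j x using that bd T by blast
  obtain k and y :: "nat \<Rightarrow> 'a" where y: "\<And>i. i < k \<Longrightarrow> y i \<in> T ` S"
    and net: "\<And>t. t \<in> T ` S \<Longrightarrow> \<exists>i<k. \<forall>j<m. \<bar>f j t - f j (y i)\<bar> < e"
    using finite_functional_net[where f = f and m = m, OF e bdT] by metis
  have k: "0 < k" using net S(2) by fastforce
  \<comment> \<open>The weight of \<open>y i\<close> is positive exactly when the first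
    \<open>m\<close> functionals all differ by less than \<open>e\<close> between \<open>t\<close>
    and \<open>y i\<close>.\<close>
  define w where "w i t = (\<Prod>j<m. max 0 (e - \<bar>f j t - f j (y i)\<bar>))" for i t
  define W where "W i t = w i t / (\<Sum>i<k. w i t)" for i t
  have w0: "0 \<le> w i t" for i t unfolding w_def by (intro prod_nonneg) auto
  have wsum: "0 < (\<Sum>i<k. w i t)" if t: "t \<in> T ` S" for t
  proof -
    obtain i where i: "i < k" "\<forall>j<m. \<bar>f j t - f j (y i)\<bar> < e" using net[OF t] by blast
    have "0 < w i t" unfolding w_def using i(2) by (intro prod_pos) auto
    then show ?thesis using i(1) w0 by (intro sum_pos2[of "{..<k}" i]) auto
  qed
  have W01: "0 \<le> W i t" "W i t \<le> 1" if "t \<in> T ` S" "i < k" for i t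
    using w0 wsum[OF that(1)] member_le_sum[of i "{..<k}" "\<lambda>i. w i t"] that(2)
    by (auto simp: W_def field_simps)
  have Wsum: "(\<Sum>i<k. W i t) = 1" if "t \<in> T ` S" for t
    using wsum[OF that] by (simp add: W_def sum_divide_distrib[symmetric])
  define Q where "Q = {x :: nat \<Rightarrow> real. \<forall>i<k. 0 \<le> x i \<and> x i \<le> 1}"
  \<comment> \<open>Coordinates with sum above 1 are scaled down; otherwise the missing mass is put
    on the vertex 0.\<close>
  define bc where "bc x i = x i / max 1 (\<Sum>i<k. x i) + (if i = 0 then max 0 (1 - (\<Sum>i<k. x i)) else 0)"
    for x :: "nat \<Rightarrow> real" and i :: nat
  define pt where "pt x = (\<Sum>i<k. bc x i *\<^sub>R y i)" for x
  have bc0: "0 \<le> bc x i" if "x \<in> Q" "i < k" for x i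
    unfolding bc_def using that by (intro add_nonneg_nonneg divide_nonneg_nonneg) (auto simp: Q_def)
  have bc1: "(\<Sum>i<k. bc x i) = 1" for x
    unfolding bc_def sum.distrib sum_divide_distrib[symmetric] using k by (simp add: max_def)
  have pt_hull: "pt x \<in> convex hull (T ` S)" if "x \<in> Q" for x
    unfolding pt_def using y bc0[OF that] bc1 by (intro convex_sum) (auto intro: hull_inc)
  have hullS: "convex hull (T ` S) \<subseteq> S" by (rule hull_minimal) (use T S in auto)
  have ptS: "pt x \<in> S" if "x \<in> Q" for x using pt_hull[OF that] hullS by blast
  define G where "G x i = W i (T (pt x))" for x i
  have "\<exists>x\<in>Q. \<forall>i<k. G x i = x i"
    unfolding Q_def
  proof (rule brouwer_cube_seq, fold Q_def)
    show "G x \<in> Q" if "x \<in> Q" for x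
      using W01[of "T (pt x)"] ptS[OF that] by (auto simp: Q_def G_def)
    fix u x i assume u: "\<And>n. u n \<in> Q" and x: "x \<in> Q"
      and ux: "\<And>j. j < k \<Longrightarrow> (\<lambda>n. u n j) \<longlonglongrightarrow> x j" and i: "i < k"
    have sum_lim: "(\<lambda>n. \<Sum>i<k. u n i) \<longlonglongrightarrow> (\<Sum>i<k. x i)" using ux by (intro tendsto_sum) auto
    have "(\<lambda>n. bc (u n) j) \<longlonglongrightarrow> bc x j" if "j < k" for j
    proof -
      have "(\<lambda>n. u n j / max 1 (\<Sum>i<k. u n i)) \<longlonglongrightarrow> x j / max 1 (\<Sum>i<k. x i)"
        by (intro tendsto_divide ux that tendsto_max tendsto_const sum_lim) simp
      moreover have "(\<lambda>n. max 0 (1 - (\<Sum>i<k. u n i))) \<longlonglongrightarrow> max 0 (1 - (\<Sum>i<k. x i))"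
        by (intro tendsto_max tendsto_diff tendsto_const sum_lim)
      ultimately show ?thesis
        unfolding bc_def by (cases "j = 0") (auto dest: tendsto_add)
    qed
    then have "wconv (\<lambda>n. pt (u n)) (pt x)" unfolding pt_def by (intro wconv_sum) auto
    then have "wconv (\<lambda>n. T (pt (u n))) (T (pt x))" by (rule cont[OF ptS[OF u] ptS[OF x]])
    then have "(\<lambda>n. f j (T (pt (u n)))) \<longlonglongrightarrow> f j (T (pt x))" for j by (rule wconv_dual[OF _ f])
    then have wl: "(\<lambda>n. w i (T (pt (u n)))) \<longlonglongrightarrow> w i (T (pt x))" for i
      unfolding w_def by (intro tendsto_prod tendsto_max tendsto_diff tendsto_rabs tendsto_const)
    have "(\<Sum>i<k. w i (T (pt x))) \<noteq> 0" using wsum[of "T (pt x)"] ptS[OF x] by simp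
    then show "(\<lambda>n. G (u n) i) \<longlonglongrightarrow> G x i"
      unfolding G_def W_def by (intro tendsto_divide tendsto_sum wl)
  qed
  then obtain x where x: "x \<in> Q" "\<And>i. i < k \<Longrightarrow> G x i = x i" by blast
  define t where "t = T (pt x)"
  have tTS: "t \<in> T ` S" using ptS[OF x(1)] by (simp add: t_def)
  have Wx: "W i t = x i" if "i < k" for i using x(2)[OF that] by (simp add: G_def t_def)
  \<comment> \<open>The coordinates of the fixed point are the weights \<open>W i t\<close>, which
    sum to 1. Hence \<open>bc\<close> leaves them unchanged and \<open>pt x\<close> is the Schauder
    projection of \<open>t\<close>.\<close>
  have sx: "(\<Sum>i<k. x i) = 1" using Wsum[OF tTS] Wx by simp
  then have "bc x i = x i" for i by (simp add: bc_def)
  then have ptx: "pt x = (\<Sum>i<k. x i *\<^sub>R y i)" by (simp add: pt_def)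
  have "\<bar>f j (pt x - t)\<bar> \<le> e" if j: "j < m" for j
  proof -
    note lin = dual_linear[OF f[of j]]
    have "f j (pt x - t) = (\<Sum>i<k. x i * f j (y i)) - (\<Sum>i<k. x i) * f j t"
      unfolding ptx sx by (simp add: linear_diff[OF lin] linear_sum[OF lin] linear_scale[OF lin])
    also have "\<dots> = (\<Sum>i<k. x i * (f j (y i) - f j t))"
      by (simp add: right_diff_distrib sum_subtractf sum_distrib_right)
    finally have "\<bar>f j (pt x - t)\<bar> \<le> (\<Sum>i<k. \<bar>x i * (f j (y i) - f j t)\<bar>)" by simp
    also have "\<dots> \<le> (\<Sum>i<k. x i * e)"
    proof (rule sum_mono)
      fix i assume "i \<in> {..<k}"
      then have i: "i < k" by simp
      have xi: "0 \<le> x i" using x(1) i by (simp add: Q_def)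
      show "\<bar>x i * (f j (y i) - f j t)\<bar> \<le> x i * e"
      proof (cases "x i = 0")
        case False
        \<comment> \<open>A nonzero coordinate means a nonzero product, and then each of its factors
          bounds a distance to \<open>y i\<close> by \<open>e\<close>.\<close>
        then have "w i t \<noteq> 0" using Wx[OF i] by (auto simp: W_def)
        then have "max 0 (e - \<bar>f j t - f j (y i)\<bar>) \<noteq> 0" using j unfolding w_def by auto
        then have "\<bar>f j (y i) - f j t\<bar> \<le> e" by (auto simp: max_def abs_minus_commute split: if_splits)
        then show ?thesis using xi by (simp add: abs_mult mult_left_mono)
      qed simp
    qed
    also have "\<dots> = e" by (simp add: sum_distrib_right[symmetric] sx)
    finally show ?thesis .
  qed
  then show ?thesis using pt_hull[OF x(1)] by (auto simp: t_def)
qed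

end

context banach_norm_function
begin

theorem weak_fixed_point:
  assumes S: "convex S" "nclosed S" "S \<noteq> {}" and R: "\<And>x. x \<in> S \<Longrightarrow> N x \<le> R"
    and T: "\<And>x. x \<in> S \<Longrightarrow> T x \<in> S"
    and cont: "\<And>u x. (\<And>n. u n \<in> S) \<Longrightarrow> x \<in> S \<Longrightarrow> wconv u x \<Longrightarrow> wconv (\<lambda>n. T (u n)) (T x)"
    and comp: "\<And>u :: nat \<Rightarrow> 'a. (\<And>n. u n \<in> S) \<Longrightarrow>
      \<exists>r x. strict_mono (r :: nat \<Rightarrow> nat) \<and> wconv (\<lambda>n. T (u (r n))) x"
  shows "\<exists>x\<in>S. T x = x"
proof -
  obtain x0 where "x0 \<in> S" using S(3) by blast
  then obtain D where D: "countable D" "x0 \<in> D" "D \<subseteq> S" "\<And>x. x \<in> D \<Longrightarrow> T x \<in> D" "convex (ncl D)"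
    using countable_dense_convex[of "{x0}" S T] S(1) T by auto
  define S' where "S' = ncl D"
  have S'S: "S' \<subseteq> S" unfolding S'_def by (rule ncl_minimal[OF D(3) S(2)])
  have S': "convex S'" "nclosed S'" "S' \<noteq> {}"
    using D(2,5) nclosed_ncl subset_ncl[of D] by (auto simp: S'_def)
  \<comment> \<open>Norm approximation of \<open>x\<close> from \<open>D\<close> is also weak, so
    \<open>T x\<close> is a weak limit of points of \<open>D\<close>, and Mazur's theorem keeps it
    in the closed convex set \<open>S'\<close>.\<close>
  have T': "T x \<in> S'" if x: "x \<in> S'" for x
  proof -
    have "\<forall>n. \<exists>d. d \<in> D \<and> N (x - d) < 1 / real (Suc n)"
    proof
      fix n
      have "0 < 1 / real (Suc n)" by simp
      then show "\<exists>d. d \<in> D \<and> N (x - d) < 1 / real (Suc n)" using x unfolding S'_def ncl_def by blast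
    qed
    from choice[OF this] obtain d where d: "\<And>n. d n \<in> D" "\<And>n. N (x - d n) < 1 / real (Suc n)" by blast
    have "(\<lambda>n. N (d n - x)) \<longlonglongrightarrow> 0"
    proof (rule Lim_null_comparison)
      show "\<forall>\<^sub>F n in sequentially. norm (N (d n - x)) \<le> 1 / real (Suc n)"
        using less_imp_le[OF d(2)] by (simp add: N_commute[of _ x])
      show "(\<lambda>n. 1 / real (Suc n)) \<longlonglongrightarrow> 0"
        using LIMSEQ_inverse_real_of_nat by (simp add: inverse_eq_divide)
    qed
    then have "wconv d x" by (rule norm_conv_imp_wconv)
    then have "wconv (\<lambda>n. T (d n)) (T x)" using d(1) D(3) x S'S by (intro cont) auto
    then show ?thesis
      by (rule mazur[OF S'(1,2), rotated]) (use D(4)[OF d(1)] subset_ncl S'_def in blast)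
  qed
  obtain f :: "nat \<Rightarrow> 'a \<Rightarrow> real" where f: "\<And>j. f j \<in> dual_ball"
    and nf: "\<And>x y e. x \<in> ncl D \<Longrightarrow> y \<in> ncl D \<Longrightarrow> (\<And>j. \<bar>f j (x - y)\<bar> \<le> e) \<Longrightarrow> N (x - y) \<le> e"
    using norming_sequence[OF D(1)] by metis
  have cont': "wconv (\<lambda>n. T (u n)) (T x)" if "\<And>n. u n \<in> S'" "x \<in> S'" "wconv u x" for u x
    using that S'S by (intro cont) auto
  have bd: "\<bar>f j x\<bar> \<le> R" if "x \<in> S'" for j x
    using dual_ball_le[OF f, of j x] R[of x] that S'S by force
  have "\<exists>x\<in>convex hull (T ` S'). \<forall>j<m. \<bar>f j (x - T x)\<bar> \<le> 1 / real (Suc m)" for m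
    by (rule approximate_fixed_point[OF S'(1,3) T' cont' dual_ball_subset[OF f] bd]) auto
  then have "\<forall>m. \<exists>x. x \<in> convex hull (T ` S') \<and> (\<forall>j<m. \<bar>f j (x - T x)\<bar> \<le> 1 / real (Suc m))" by blast
  from choice[OF this] obtain u where u: "\<And>m. u m \<in> convex hull (T ` S')"
    and uT: "\<And>m j. j < m \<Longrightarrow> \<bar>f j (u m - T (u m))\<bar> \<le> 1 / real (Suc m)" by blast
  have K: "\<exists>r x. strict_mono (r :: nat \<Rightarrow> nat) \<and> wconv (\<lambda>n. k (r n)) x" if k: "\<And>n. k n \<in> T ` S'" for k
  proof -
    have "\<forall>n. \<exists>x. x \<in> S' \<and> k n = T x" using k by blast
    from choice[OF this] obtain v where v: "\<And>n. v n \<in> S'" "\<And>n. k n = T (v n)" by blast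
    have "v n \<in> S" for n using v(1) S'S by blast
    from comp[of v, OF this] show ?thesis by (simp add: v(2))
  qed
  have R': "N x \<le> R" if "x \<in> ncl D" for x using R S'S that by (auto simp: S'_def)
  have KS': "T ` S' \<subseteq> ncl D" using T' by (auto simp: S'_def)
  have "\<exists>r x. strict_mono (r :: nat \<Rightarrow> nat) \<and> x \<in> ncl D \<and> wconv (\<lambda>n. u (r n)) x"
    by (rule krein[OF D(1,5) KS' K R' u])
  then obtain r x where r: "strict_mono (r :: nat \<Rightarrow> nat)" and x: "x \<in> S'" and ux: "wconv (\<lambda>n. u (r n)) x"
    unfolding S'_def by blast
  have "convex hull (T ` S') \<subseteq> S'" by (rule hull_minimal) (use T' S' in auto)
  then have "u n \<in> S'" for n using u by blast
  then have "wconv (\<lambda>n. T (u (r n))) (T x)" using x ux by (intro cont') auto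
  with ux have conv: "wconv (\<lambda>n. u (r n) - T (u (r n))) (x - T x)" by (rule wconv_diff)
  have fx: "f j (x - T x) = 0" for j
  proof -
    have "(\<lambda>n. f j (u (r n) - T (u (r n)))) \<longlonglongrightarrow> f j (x - T x)"
      by (rule wconv_dual[OF conv dual_ball_subset[OF f]])
    moreover have "(\<lambda>n. f j (u (r n) - T (u (r n)))) \<longlonglongrightarrow> 0"
    proof (rule Lim_null_comparison)
      show "(\<lambda>n. 1 / real (Suc (r n))) \<longlonglongrightarrow> 0"
        using LIMSEQ_subseq_LIMSEQ[OF LIMSEQ_inverse_real_of_nat r] by (simp add: o_def inverse_eq_divide)
      show "\<forall>\<^sub>F n in sequentially. norm (f j (u (r n) - T (u (r n)))) \<le> 1 / real (Suc (r n))"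
        using eventually_gt_at_top[of j]
      proof eventually_elim
        case (elim n)
        then have "j < r n" using strict_mono_imp_increasing[OF r, of n] by linarith
        then show ?case using uT by simp
      qed
    qed
    ultimately show ?thesis by (rule LIMSEQ_unique)
  qed
  have "N (x - T x) \<le> 0"
    using x T'[OF x] by (intro nf) (auto simp: S'_def fx)
  then have "N (x - T x) = 0" using N_nonneg[of "x - T x"] by linarith
  then have "T x = x" by (simp add: N_eq_0_iff)
  then show ?thesis using x S'S by blast
qed

end

section \<open>Generalized Banach spaces\<close>

definition max_norm :: "('a::real_vector \<Rightarrow> real ^ 'n) \<Rightarrow> 'a \<Rightarrow> real" where
  "max_norm vnorm x = Max (range (\<lambda>i. vnorm x $ i))"

lemma vdist_eq_max_norm: "vdist vnorm x y = max_norm vnorm (x - y)"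
  by (simp add: vdist_def max_norm_def)

context generalized_banach_space
begin

sublocale M: Metric_space UNIV "vdist vnorm"
  by (rule Metric_space_vdist)

lemma vnorm_topology_eq: "vnorm_topology vnorm = M.mtopology"
  by (simp add: vnorm_topology_def)

sublocale banach_norm_function "max_norm vnorm"
proof
  fix x y and c :: real
  show "max_norm vnorm x = 0 \<longleftrightarrow> x = 0"
    using M.zero[of x 0] by (simp add: vdist_eq_max_norm)
  have "mono (\<lambda>t. \<bar>c\<bar> * t)" by (auto intro!: monoI mult_left_mono)
  from mono_Max_commute[OF this, of "range (\<lambda>i. vnorm x $ i)"]
  show "max_norm vnorm (c *\<^sub>R x) = \<bar>c\<bar> * max_norm vnorm x"
    by (simp add: max_norm_def vnorm_scaleR image_image)
  show "max_norm vnorm (x + y) \<le> max_norm vnorm x + max_norm vnorm y"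
    using M.triangle[of x 0 "- y"] by (simp add: vdist_eq_max_norm)
next
  fix u :: "nat \<Rightarrow> 'a"
  assume "\<And>e. 0 < e \<Longrightarrow> \<exists>L. \<forall>m\<ge>L. \<forall>n\<ge>L. max_norm vnorm (u m - u n) < e"
  then have "M.MCauchy u" unfolding M.MCauchy_def by (simp add: vdist_eq_max_norm)
  then obtain x where "limitin M.mtopology u x sequentially"
    using complete unfolding M.mcomplete_def by blast
  then have "(\<lambda>n. vdist vnorm (u n) x) \<longlonglongrightarrow> 0"
    by (simp add: M.limitin_metric_dist_null)
  then show "\<exists>x. (\<lambda>n. max_norm vnorm (u n - x)) \<longlonglongrightarrow> 0"
    by (auto simp: vdist_eq_max_norm)
qed

text \<open>Continuity at 0 bounds a linear functional by 1 on a ball of radius \<open>r\<close>;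
  scaling a vector to norm \<open>r / 2\<close> turns this into a bound with factor
  \<open>2 / r\<close>.\<close>

lemma dual_eq: "dual = {f. linear f \<and> continuous_map (vnorm_topology vnorm) euclideanreal f}"
proof (intro set_eqI iffI CollectI conjI)
  fix f assume f: "f \<in> dual"
  show "linear f" using f by (rule dual_linear)
  obtain C where C: "0 < C" "\<And>x. \<bar>f x\<bar> \<le> C * max_norm vnorm x" using dual_bound[OF f] by blast
  have "openin M.mtopology {x. f x \<in> V}" if V: "open V" for V
    unfolding M.openin_mtopology
  proof (intro conjI allI impI)
    fix x assume "x \<in> {x. f x \<in> V}"
    then obtain e where e: "0 < e" "\<And>t. \<bar>t - f x\<bar> < e \<Longrightarrow> t \<in> V"
      using V unfolding open_dist by (auto simp: dist_real_def)
    have "f y \<in> V" if "vdist vnorm x y < e / C" for y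
    proof (rule e(2))
      have "\<bar>f y - f x\<bar> \<le> C * max_norm vnorm (y - x)"
        using C(2)[of "y - x"] by (simp add: linear_diff[OF dual_linear[OF f]])
      also have "\<dots> < e" using that C(1) M.commute[of x y] by (simp add: vdist_eq_max_norm field_simps)
      finally show "\<bar>f y - f x\<bar> < e" .
    qed
    then show "\<exists>r>0. M.mball x r \<subseteq> {x. f x \<in> V}"
      using e(1) C(1) by (intro exI[of _ "e / C"]) auto
  qed auto
  then show "continuous_map (vnorm_topology vnorm) euclideanreal f"
    by (simp add: continuous_map_def vnorm_topology_eq)
next
  fix f assume "f \<in> {f. linear f \<and> continuous_map (vnorm_topology vnorm) euclideanreal f}"
  then have f: "linear f" and cont: "continuous_map M.mtopology euclideanreal f"
    by (auto simp: vnorm_topology_eq)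
  have "openin M.mtopology {x \<in> topspace M.mtopology. f x \<in> {-1<..<1}}"
    by (rule openin_continuous_map_preimage[OF cont]) simp
  moreover have "0 \<in> {x \<in> topspace M.mtopology. f x \<in> {-1<..<1}}"
    using linear_0[OF f] by simp
  ultimately obtain r where r: "0 < r" "M.mball 0 r \<subseteq> {x \<in> topspace M.mtopology. f x \<in> {-1<..<1}}"
    unfolding M.openin_mtopology by blast
  have small: "\<bar>f x\<bar> < 1" if "max_norm vnorm x < r" for x
  proof -
    have "x \<in> M.mball 0 r" using that N_minus[of x] by (simp add: vdist_eq_max_norm)
    then show ?thesis using r(2) by (auto simp: abs_less_iff)
  qed
  have "\<bar>f x\<bar> \<le> (2 / r) * max_norm vnorm x" for x
  proof (cases "x = 0")
    case True
    then show ?thesis using linear_0[OF f] by simp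
  next
    case False
    define c where "c = r / (2 * max_norm vnorm x)"
    have pos: "0 < max_norm vnorm x" using False N_nonneg[of x] N_eq_0_iff[of x] by linarith
    then have c: "0 < c" using r(1) by (simp add: c_def)
    have "max_norm vnorm (c *\<^sub>R x) = r / 2"
      using pos r(1) by (simp add: N_scale c_def)
    then have "\<bar>f (c *\<^sub>R x)\<bar> < 1" using r(1) by (intro small) simp
    then have "c * \<bar>f x\<bar> < 1" using c by (simp add: linear_scale[OF f] abs_mult)
    then show ?thesis using pos r(1) by (simp add: c_def field_simps)
  qed
  then show "f \<in> dual" using f unfolding dual_def by blast
qed

section \<open>Weak topology, weak convergence and weak compactness\<close>

lemma weak_topology_eq: "weak_topology vnorm = topology_generated_by {f -` V |f V. f \<in> dual \<and> open V}"
  unfolding weak_topology_def dual_eq by (simp add: conj_assoc)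

lemma openin_weak: "f \<in> dual \<Longrightarrow> open V \<Longrightarrow> openin (weak_topology vnorm) (f -` V)"
  unfolding weak_topology_eq by (rule topology_generated_by_Basis) blast

lemma zero_dual: "(\<lambda>_. 0) \<in> dual"
  unfolding dual_def by (auto intro!: exI[of _ 0] linearI)

lemma topspace_weak: "topspace (weak_topology vnorm) = UNIV"
  using openin_subset[OF openin_weak[OF zero_dual open_UNIV]] by auto

text \<open>Eventual membership in neighbourhoods of the limit can be checked on generating sets,
  since it is inherited by finite intersections and by unions.\<close>

lemma weakly_converges_eq: "weakly_converges vnorm = wconv"
proof (intro ext iffI)
  fix u x assume "weakly_converges vnorm u x"
  then have ev: "\<forall>\<^sub>F n in sequentially. u n \<in> V" if "openin (weak_topology vnorm) V" "x \<in> V" for V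
    using that by (auto simp: weakly_converges_def limitin_def)
  show "wconv u x"
    unfolding wconv_def
  proof (intro ballI topological_tendstoI)
    fix f V assume "f \<in> dual" "open V" "f x \<in> V"
    then show "\<forall>\<^sub>F n in sequentially. f (u n) \<in> V" using ev[OF openin_weak[of f V]] by simp
  qed
next
  fix u x assume wc: "wconv u x"
  have "\<forall>\<^sub>F n in sequentially. u n \<in> V"
    if "generate_topology_on {f -` V |f V. f \<in> dual \<and> open V} V" "x \<in> V" for V
    using that
  proof induction
    case (Int a b)
    then show ?case by (auto intro: eventually_conj)
  next
    case (UN K)
    then obtain k where "k \<in> K" "x \<in> k" by blast
    from UN(2)[OF this] show ?case by eventually_elim (use \<open>k \<in> K\<close> in blast)
  next
    case (Basis s)
    then obtain f V where s: "s = f -` V" "f \<in> dual" "open V" by blast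
    then have "\<forall>\<^sub>F n in sequentially. f (u n) \<in> V"
      using Basis(2) by (intro topological_tendstoD[OF wconv_dual[OF wc]]) auto
    then show ?case by (simp add: s(1))
  qed auto
  then show "weakly_converges vnorm u x"
    using openin_topology_generated_by unfolding weakly_converges_def limitin_def topspace_weak
    by (auto simp: weak_topology_eq)
qed

text \<open>Without a cluster point, \<open>C\<close> would be covered by open sets that the
  sequence eventually leaves, hence by finitely many of them.\<close>

lemma compactin_cluster_point:
  assumes "compactin X C" "\<And>n :: nat. v n \<in> C"
  shows "\<exists>x. \<forall>V. openin X V \<longrightarrow> x \<in> V \<longrightarrow> (\<exists>\<^sub>F n in sequentially. v n \<in> V)"
proof (rule ccontr)
  assume "\<not> ?thesis"
  then have "\<forall>x. \<exists>V. openin X V \<and> x \<in> V \<and> (\<forall>\<^sub>F n in sequentially. v n \<notin> V)"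
    by (simp add: frequently_def)
  then have "C \<subseteq> \<Union>{V. openin X V \<and> (\<forall>\<^sub>F n in sequentially. v n \<notin> V)}" by blast
  with assms(1) obtain \<F> where \<F>: "finite \<F>"
      "\<F> \<subseteq> {V. openin X V \<and> (\<forall>\<^sub>F n in sequentially. v n \<notin> V)}" "C \<subseteq> \<Union>\<F>"
    unfolding compactin_def by (metis (no_types, lifting) mem_Collect_eq)
  then have "\<forall>\<^sub>F n in sequentially. \<forall>V\<in>\<F>. v n \<notin> V"
    by (intro eventually_ball_finite) auto
  then obtain n where "\<forall>V\<in>\<F>. v n \<notin> V" by (auto simp: eventually_sequentially)
  then show False using assms(2)[of n] \<F>(3) by blast
qed

lemma relatively_weakly_compact_subseq:
  assumes "relatively_weakly_compact vnorm K" "\<And>n. v n \<in> K"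
  shows "\<exists>r x. strict_mono (r :: nat \<Rightarrow> nat) \<and> wconv (\<lambda>n. v (r n)) x"
proof (rule eberlein_smulian)
  fix r :: "nat \<Rightarrow> nat"
  have sub: "K \<subseteq> weak_topology vnorm closure_of K"
    by (rule closure_of_subset) (simp add: topspace_weak)
  have "\<exists>x. \<forall>V. openin (weak_topology vnorm) V \<longrightarrow> x \<in> V \<longrightarrow> (\<exists>\<^sub>F n in sequentially. v (r n) \<in> V)"
    by (rule compactin_cluster_point[where C = "weak_topology vnorm closure_of K"])
      (use assms sub in \<open>auto simp: relatively_weakly_compact_def\<close>)
  then obtain x where x: "\<And>V. openin (weak_topology vnorm) V \<Longrightarrow> x \<in> V \<Longrightarrow> \<exists>\<^sub>F n in sequentially. v (r n) \<in> V"
    by blast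
  have "\<exists>\<^sub>F n in sequentially. \<bar>f (v (r n)) - f x\<bar> < e" if "f \<in> dual" "0 < e" for f e
    using x[OF openin_weak[OF that(1), of "ball (f x) e"]] that(2)
    by (simp add: dist_real_def abs_minus_commute)
  then show "\<exists>x. \<forall>f\<in>dual. \<forall>e>0. \<exists>\<^sub>F n in sequentially. \<bar>f (v (r n)) - f x\<bar> < e" by blast
qed

lemma nclosed_if_closedin:
  assumes "closedin (vnorm_topology vnorm) S"
  shows "nclosed S"
  unfolding nclosed_def
proof (intro allI impI)
  fix x assume x: "\<forall>e>0. \<exists>s\<in>S. max_norm vnorm (x - s) < e"
  show "x \<in> S"
  proof (rule ccontr)
    assume "x \<notin> S"
    then obtain r where r: "0 < r" "disjnt S (M.mball x r)"
      using assms unfolding vnorm_topology_eq M.closedin_metric by blast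
    then obtain s where "s \<in> S" "max_norm vnorm (x - s) < r" using x by blast
    then have "s \<in> S \<inter> M.mball x r" by (simp add: vdist_eq_max_norm)
    then show False using r(2) by (auto simp: disjnt_def)
  qed
qed

lemma vbounded_imp_bounded:
  assumes "vbounded vnorm S"
  obtains R where "\<And>x. x \<in> S \<Longrightarrow> max_norm vnorm x \<le> R"
proof -
  obtain c B where c: "S \<subseteq> M.mcball c B" using assms unfolding vbounded_def M.mbounded_def by blast
  have "max_norm vnorm x \<le> max_norm vnorm c + B" if "x \<in> S" for x
    using N_triangle[of c "x - c"] N_commute[of x c] c that by (auto simp: vdist_eq_max_norm)
  then show thesis by (rule that)
qed

end

text \<open>Of the two identities for the inverse \<open>b\<close>, one makes
  \<open>b * (x - C x)\<close> a solution and the other makes it the only one, so the description in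
  \<open>quotient_op\<close> is proper.\<close>

lemma quotient_op_iff:
  assumes "invertible_elem (A x)"
  shows "quotient_op A C x = z \<longleftrightarrow> A x * z = x - C x"
proof -
  obtain e b where e: "is_unit_element e" and b: "A x * b = e" "b * A x = e"
    using assms unfolding invertible_elem_def by blast
  have e1: "e * y = y" for y using e by (simp add: is_unit_element_def)
  have sol: "A x * w = x - C x \<longleftrightarrow> w = b * (x - C x)" for w
  proof
    assume "A x * w = x - C x"
    then have "b * (x - C x) = (b * A x) * w" by (simp add: mult.assoc)
    then show "w = b * (x - C x)" by (simp add: b e1)
  next
    assume "w = b * (x - C x)"
    then have "A x * w = (A x * b) * (x - C x)" by (simp add: mult.assoc)
    then show "A x * w = x - C x" by (simp add: b e1)
  qed
  show ?thesis unfolding quotient_op_def sol by auto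
qed

section \<open>Reduction of the operator equation to a fixed point problem\<close>

theorem theorem3p3:
  fixes vnorm :: "'a::real_algebra \<Rightarrow> real ^ 'n"
    and S :: "'a set"
    and A B C :: "'a \<Rightarrow> 'a"
  assumes "generalized_banach_algebra vnorm"
    and "condition_GP vnorm"
    and "S \<noteq> {}" and "vbounded vnorm S" and "closedin (vnorm_topology vnorm) S" and "convex S"
    and "weakly_seq_continuous_on vnorm S A"
    and "weakly_seq_continuous_on vnorm S B"
    and "weakly_seq_continuous_on vnorm S C"
    and i: "regular_on S A"
    and ii: "weakly_compact_on vnorm S A" "weakly_compact_on vnorm S B"
    and iii: "\<And>u y. (\<forall>k. u k \<in> S) \<Longrightarrow> weakly_converges vnorm (\<lambda>k. u k - C (u k)) y \<Longrightarrow>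
               \<exists>r x. strict_mono (r :: nat \<Rightarrow> nat) \<and> weakly_converges vnorm (u \<circ> r) x"
    and iv: "inverse_exists_on S (quotient_op A C) (B ` S)"
    and v: "\<And>x y. y \<in> S \<Longrightarrow> x = A x * B y + C x \<Longrightarrow> A x * B y + C x \<in> S \<Longrightarrow> x \<in> S"
  shows "\<exists>x\<in>S. x = A x * B x + C x"
proof -
  interpret generalized_banach_algebra vnorm by fact
  note weakly_converges_eq [simp]
  have S: "convex S" "nclosed S" "S \<noteq> {}" using assms nclosed_if_closedin by auto
  obtain R where R: "\<And>x. x \<in> S \<Longrightarrow> max_norm vnorm x \<le> R" using vbounded_imp_bounded assms(4) by blast
  have GP: "wconv (\<lambda>k. u k * w k) (x * y)" if "wconv u x" "wconv w y" for u w x y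
    using assms(2) that by (simp add: condition_GP_def)
  have cont: "wconv (\<lambda>k. A (u k)) (A x)" "wconv (\<lambda>k. B (u k)) (B x)" "wconv (\<lambda>k. C (u k)) (C x)"
    if "\<And>k. u k \<in> S" "x \<in> S" "wconv u x" for u x
    using assms(7-9) that by (auto simp: weakly_seq_continuous_on_def)
  have comp: "relatively_weakly_compact vnorm (A ` S)" "relatively_weakly_compact vnorm (B ` S)"
    using ii assms(4) by (auto simp: weakly_compact_on_def)
  have ex1: "\<exists>!x. x \<in> S \<and> A x * B y = x - C x" if "y \<in> S" for y
  proof -
    have "\<exists>!x. x \<in> S \<and> quotient_op A C x = B y" using iv that by (auto simp: inverse_exists_on_def)
    moreover have "quotient_op A C x = B y \<longleftrightarrow> A x * B y = x - C x" if "x \<in> S" for x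
      using i that by (intro quotient_op_iff) (simp add: regular_on_def)
    ultimately show ?thesis by metis
  qed
  define T where "T y = (THE x. x \<in> S \<and> A x * B y = x - C x)" for y
  have T: "T y \<in> S" "A (T y) * B y = T y - C (T y)" if "y \<in> S" for y
    using theI'[OF ex1[OF that]] by (simp_all add: T_def)
  have T_unique: "x = T y" if "y \<in> S" "x \<in> S" "A x * B y = x - C x" for x y
    using ex1[OF that(1)] T[OF that(1)] that by blast
  have compT: "\<exists>r x. strict_mono (r :: nat \<Rightarrow> nat) \<and> wconv (\<lambda>n. T (y (r n))) x"
    if y: "\<And>n. y n \<in> S" for y :: "nat \<Rightarrow> 'a"
  proof -
    obtain r b where r: "strict_mono (r :: nat \<Rightarrow> nat)" "wconv (\<lambda>n. B (y (r n))) b"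
      using relatively_weakly_compact_subseq[OF comp(2), of "\<lambda>n. B (y n)"] y by blast
    obtain s a where s: "strict_mono (s :: nat \<Rightarrow> nat)" "wconv (\<lambda>n. A (T (y (r (s n))))) a"
      using relatively_weakly_compact_subseq[OF comp(1), of "\<lambda>n. A (T (y (r n)))"] y T(1) by blast
    \<comment> \<open>By the equation defining \<open>T\<close> these products are values of
      \<open>I - C\<close>, so their weak convergence is what \<open>iii\<close> asks for.\<close>
    have "wconv (\<lambda>n. A (T (y (r (s n)))) * B (y (r (s n)))) (a * b)"
      by (rule GP[OF s(2) wconv_subseq[OF r(2) s(1)]])
    then have "wconv (\<lambda>n. T (y (r (s n))) - C (T (y (r (s n))))) (a * b)"
      using T(2)[OF y] by simp
    then have "\<exists>q x. strict_mono (q :: nat \<Rightarrow> nat) \<and> wconv (\<lambda>n. T (y (r (s (q n))))) x"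
      using iii[of "\<lambda>n. T (y (r (s n)))"] T(1)[OF y] by (simp add: o_def)
    then obtain q x where q: "strict_mono (q :: nat \<Rightarrow> nat)" "wconv (\<lambda>n. T (y (r (s (q n))))) x"
      by blast
    have "strict_mono (\<lambda>n. r (s (q n)))" using r(1) s(1) q(1) by (auto simp: strict_mono_def)
    with q(2) show ?thesis by (intro exI[of _ "\<lambda>n. r (s (q n))"] exI[of _ x]) simp
  qed
  have contT: "wconv (\<lambda>n. T (u n)) (T x)" if u: "\<And>n. u n \<in> S" and x: "x \<in> S" and ux: "wconv u x" for u x
    unfolding wconv_def
  proof (intro ballI tendsto_if_subseqs)
    fix f and r :: "nat \<Rightarrow> nat" assume f: "f \<in> dual" and r: "strict_mono r"
    obtain q z where q: "strict_mono (q :: nat \<Rightarrow> nat)" and z: "wconv (\<lambda>n. T (u (r (q n)))) z"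
      using compT[of "\<lambda>n. u (r n)"] u by blast
    \<comment> \<open>The weak sequential continuity of \<open>A\<close> and \<open>C\<close> is
      available at \<open>z\<close> only once \<open>z\<close> is known to lie in
      \<open>S\<close>.\<close>
    have zS: "z \<in> S" by (rule mazur[OF S(1,2) _ z]) (rule T(1)[OF u])
    have "wconv (\<lambda>n. u (r (q n))) x"
      by (rule wconv_subseq[OF wconv_subseq[OF ux r] q])
    then have "wconv (\<lambda>n. A (T (u (r (q n)))) * B (u (r (q n)))) (A z * B x)"
      using cont(1)[OF T(1)[OF u] zS z] cont(2)[OF u x] by (intro GP)
    moreover have "wconv (\<lambda>n. A (T (u (r (q n)))) * B (u (r (q n)))) (z - C z)"
      using wconv_diff[OF z cont(3)[OF T(1)[OF u] zS z]] T(2)[OF u] by simp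
    \<comment> \<open>The limit equation characterises \<open>T x\<close>, so all subsequences lead
      to the same limit.\<close>
    ultimately have "A z * B x = z - C z" by (rule wconv_unique)
    then have "z = T x" by (rule T_unique[OF x zS])
    then show "\<exists>q. strict_mono q \<and> (\<lambda>n. f (T (u (r (q n))))) \<longlonglongrightarrow> f (T x)"
      using q wconv_dual[OF z f] by auto
  qed
  have "\<exists>x\<in>S. T x = x"
    by (rule weak_fixed_point[OF S R T(1) contT compT])
  then obtain x where "x \<in> S" "A x * B x = x - C x" using T(2) by metis
  then show ?thesis by (intro bexI[of _ x]) auto
qed

end
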